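(* Let $\overline\rho>0$, $f\in C^1[0,\overline\rho]$ with $f(0)=0$, $h:=f'$, let $D\in C^1[0,\overline\rho]$ satisfy $D(\overline\rho)=0$ and $D(\rho)>0$ for $\rho\in(0,\overline\rho)$, and let $g\in C[0,\overline\rho]$ satisfy $g(\rho)>0$ for $\rho\in[0,\overline\rho)$ and $g(\overline\rho)=0$. Let $\varphi$ be a wave profile, with wave speed $c\in\mathbb R$, of some semi-wavefront solution from $\overline\rho$ (resp., to $\overline\rho$) of the equation $$\rho_t+f(\rho)_x=\left(D(\rho)\rho_x\right)_x+g(\rho),\qquad t\ge 0,\ x\in\mathbb R,$$ and let $L>0$ be a constant. (i) If $g(\rho)\le L(\overline\rho-\rho)$ in a left neighborhood of $\overline\rho$ and $c>h(\overline\rho)$ (resp., $c<h(\overline\rho)$), then $\varphi$ is strictly monotone, i.e., $\varphi(\xi)<\overline\rho$ for every $\xi$ in its domain. (ii) If $g(\rho)\ge L(\overline\rho-\rho)^{\alpha}$ in a left neighborhood of $\overline\rho$ for some $\alpha\in(0,1)$, then $\varphi$ is non-strictly monotone, i.e., $\varphi(\xi)\equiv\overline\rho$ in $(-\infty,\overline\xi]$ (resp., in $[\overline\xi,+\infty)$) for some $\overline\xi$ in its domain.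
   Context: A prime on profiles denotes differentiation with respect to $\xi$. Only classical or sharp traveling-wave solutions are considered throughout. Traveling waves. Let $I\subseteq\mathbb R$ be an open interval and $\varphi\colon I\to[0,\overline\rho]$ with $\varphi\in C(I)$ and $D(\varphi)\varphi'\in L^1_{\rm loc}(I)$ (in particular $\varphi$ is differentiable a.e.). The function $\rho(x,t)=\varphi(x-ct)$, defined for $x-ct\in I$, is a traveling-wave solution with wave speed $c$ and wave profile $\varphi$ if $$\int_I\left\{\left(D(\varphi(\xi))\varphi'(\xi)-f(\varphi(\xi))+c\varphi(\xi)\right)\psi'(\xi)-g(\varphi(\xi))\psi(\xi)\right\}d\xi=0\quad\text{for every }\psi\in C_0^\infty(I).$$ It is: classical if $\varphi$ is differentiable, $D(\varphi)\varphi'$ is absolutely continuous and $(D(\varphi)\varphi')'+(c-h(\varphi))\varphi'+g(\varphi)=0$ holds a.e. in $I$; sharp at $\ell$ if $g(\ell)=0$ and there is $\xi_0\in I$ with $\varphi(\xi_0)=\ell$, $\varphi$ classical in $I\setminus\{\xi_0\}$ and $\varphi$ not differentiable at $\xi_0$. Semi-wavefronts. A traveling-wave solution whose profile $\varphi$ is defined in $(-\infty,\varpi)$, $\varpi\in\mathbb R$, is a semi-wavefront solution from $\overline\rho$ (here $g(\overline\rho)=0$) if $\varphi$ is monotonic (in the weak sense), non-constant, and $\varphi(\xi)\to\overline\rho$ as $\xi\to-\infty$. It is a semi-wavefront solution to $\overline\rho$ if $\varphi$ is defined in $(\varpi,+\infty)$, is monotonic, non-constant, and $\varphi(\xi)\to\overline\rho$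 as $\xi\to+\infty$. *)

theory Defs
  imports "HOL-Analysis.Analysis"
begin

text \<open>
  Functions on an interval are total functions \<open>real \<Rightarrow> real\<close>; only their values on the stated
  interval matter. Profiles live on open intervals, so \<^term>\<open>deriv \<phi> \<xi>\<close> depends only on the values
  of \<open>\<phi>\<close> there; where \<open>\<phi>\<close> is not differentiable, \<^term>\<open>deriv \<phi> \<xi>\<close> is an unspecified number
  (this happens on a null set only).
\<close>

text \<open>The space of smooth functions with compact support in \<open>I\<close>.\<close>

definition test_function :: "real set \<Rightarrow> (real \<Rightarrow> real) \<Rightarrow> bool" where
  "test_function I \<psi> \<longleftrightarrow>
     (\<forall>n x. ((deriv ^^ n) \<psi>) differentiable (at x)) \<and>
     compact (closure {x. \<psi> x \<noteq> 0}) \<and> closure {x. \<psi> x \<noteq> 0} \<subseteq> I"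

text \<open>
  The usual epsilon-delta definition: a division of a subset \<open>T\<close> of \<open>S\<close> is a finite family of compact
  intervals contained in \<open>S\<close> with pairwise disjoint interiors.
\<close>

definition abs_continuous_on :: "real set \<Rightarrow> (real \<Rightarrow> real) \<Rightarrow> bool" where
  "abs_continuous_on S F \<longleftrightarrow>
     (\<forall>\<epsilon>>0. \<exists>\<delta>>0. \<forall>d T. d division_of T \<and> T \<subseteq> S \<and> (\<Sum>k\<in>d. Sup k - Inf k) < \<delta> \<longrightarrow>
        (\<Sum>k\<in>d. \<bar>F (Sup k) - F (Inf k)\<bar>) < \<epsilon>)"

text \<open>On an open set, absolute continuity is understood on compact subintervals.\<close>

definition loc_abs_continuous_on :: "real set \<Rightarrow> (real \<Rightarrow> real) \<Rightarrow> bool" where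
  "loc_abs_continuous_on S F \<longleftrightarrow> (\<forall>a b. {a..b} \<subseteq> S \<longrightarrow> abs_continuous_on {a..b} F)"

text \<open>
  The equation is \<open>\<rho>\<^sub>t + f(\<rho>)\<^sub>x = (D(\<rho>) \<rho>\<^sub>x)\<^sub>x + g(\<rho>)\<close> with densities in \<open>[0, rbar]\<close>, and \<open>h = f'\<close>.
\<close>

definition traveling_wave ::
  "real \<Rightarrow> (real \<Rightarrow> real) \<Rightarrow> (real \<Rightarrow> real) \<Rightarrow> (real \<Rightarrow> real) \<Rightarrow>
   real \<Rightarrow> real set \<Rightarrow> (real \<Rightarrow> real) \<Rightarrow> bool" where
  "traveling_wave rbar D f g c I \<phi> \<longleftrightarrow>
     open I \<and> is_interval I \<and> \<phi> ` I \<subseteq> {0..rbar} \<and> continuous_on I \<phi> \<and>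
     (AE \<xi> in lebesgue. \<xi> \<in> I \<longrightarrow> \<phi> differentiable (at \<xi>)) \<and>
     (\<forall>K. compact K \<and> K \<subseteq> I \<longrightarrow> set_integrable lebesgue K (\<lambda>\<xi>. D (\<phi> \<xi>) * deriv \<phi> \<xi>)) \<and>
     (\<forall>\<psi>. test_function I \<psi> \<longrightarrow>
        (LINT \<xi>:I|lebesgue.
           (D (\<phi> \<xi>) * deriv \<phi> \<xi> - f (\<phi> \<xi>) + c * \<phi> \<xi>) * deriv \<psi> \<xi> - g (\<phi> \<xi>) * \<psi> \<xi>) = 0)"

definition classical_on ::
  "(real \<Rightarrow> real) \<Rightarrow> (real \<Rightarrow> real) \<Rightarrow> (real \<Rightarrow> real) \<Rightarrow>
   real \<Rightarrow> real set \<Rightarrow> (real \<Rightarrow> real) \<Rightarrow> bool" where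
  "classical_on D h g c S \<phi> \<longleftrightarrow>
     (\<forall>\<xi>\<in>S. \<phi> differentiable (at \<xi>)) \<and>
     loc_abs_continuous_on S (\<lambda>\<xi>. D (\<phi> \<xi>) * deriv \<phi> \<xi>) \<and>
     (AE \<xi> in lebesgue. \<xi> \<in> S \<longrightarrow>
        (\<lambda>\<zeta>. D (\<phi> \<zeta>) * deriv \<phi> \<zeta>) differentiable (at \<xi>) \<and>
        deriv (\<lambda>\<zeta>. D (\<phi> \<zeta>) * deriv \<phi> \<zeta>) \<xi> + (c - h (\<phi> \<xi>)) * deriv \<phi> \<xi> + g (\<phi> \<xi>) = 0)"

definition sharp_at ::
  "(real \<Rightarrow> real) \<Rightarrow> (real \<Rightarrow> real) \<Rightarrow> (real \<Rightarrow> real) \<Rightarrow>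
   real \<Rightarrow> real set \<Rightarrow> (real \<Rightarrow> real) \<Rightarrow> real \<Rightarrow> bool" where
  "sharp_at D h g c I \<phi> l \<longleftrightarrow>
     g l = 0 \<and>
     (\<exists>\<xi>\<^sub>0\<in>I. \<phi> \<xi>\<^sub>0 = l \<and> classical_on D h g c (I - {\<xi>\<^sub>0}) \<phi> \<and> \<not> \<phi> differentiable (at \<xi>\<^sub>0))"

definition wave_profile ::
  "real \<Rightarrow> (real \<Rightarrow> real) \<Rightarrow> (real \<Rightarrow> real) \<Rightarrow> (real \<Rightarrow> real) \<Rightarrow> (real \<Rightarrow> real) \<Rightarrow>
   real \<Rightarrow> real set \<Rightarrow> (real \<Rightarrow> real) \<Rightarrow> bool" where
  "wave_profile rbar D f h g c I \<phi> \<longleftrightarrow>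
     traveling_wave rbar D f g c I \<phi> \<and>
     (classical_on D h g c I \<phi> \<or> (\<exists>l. sharp_at D h g c I \<phi> l))"

definition semi_wavefront_from ::
  "real \<Rightarrow> (real \<Rightarrow> real) \<Rightarrow> (real \<Rightarrow> real) \<Rightarrow> (real \<Rightarrow> real) \<Rightarrow> (real \<Rightarrow> real) \<Rightarrow>
   real \<Rightarrow> real \<Rightarrow> (real \<Rightarrow> real) \<Rightarrow> bool" where
  "semi_wavefront_from rbar D f h g c w \<phi> \<longleftrightarrow>
     wave_profile rbar D f h g c {..<w} \<phi> \<and>
     (mono_on {..<w} \<phi> \<or> antimono_on {..<w} \<phi>) \<and>
     \<not> \<phi> constant_on {..<w} \<and> (\<phi> \<longlongrightarrow> rbar) at_bot"

definition semi_wavefront_to ::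
  "real \<Rightarrow> (real \<Rightarrow> real) \<Rightarrow> (real \<Rightarrow> real) \<Rightarrow> (real \<Rightarrow> real) \<Rightarrow> (real \<Rightarrow> real) \<Rightarrow>
   real \<Rightarrow> real \<Rightarrow> (real \<Rightarrow> real) \<Rightarrow> bool" where
  "semi_wavefront_to rbar D f h g c w \<phi> \<longleftrightarrow>
     wave_profile rbar D f h g c {w<..} \<phi> \<and>
     (mono_on {w<..} \<phi> \<or> antimono_on {w<..} \<phi>) \<and>
     \<not> \<phi> constant_on {w<..} \<and> (\<phi> \<longlongrightarrow> rbar) at_top"

end

(*
  With G = D(phi) phi' - f(phi) + c phi the equation reads G' = - g(phi) wherever phi < rbar.
  Put u = rbar - phi and q(r) = c r - f(r), for a profile starting from rbar; then G <= q(phi).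

  (i) If phi = rbar exactly up to a, the weak formulation forbids a jump of G at a, so
  q(rbar) - G(x) is the integral of g(phi) over [a,x], hence at most L (x - a) u(x). But
  q(rbar) - G(x) >= q(rbar) - q(phi(x)) >= eta u(x) with eta > 0, which is absurd for x near a.

  (ii) If phi < rbar everywhere, then G <= q(rbar). Integrating G' over a time step
  C u^(1-alpha) before x shows that u is at least halved when going back by that step. The steps
  form a convergent geometric series, so u vanishes at a finite point.

  Profiles ending at rbar are reduced to this case by the reflection x -> -x, f -> -f, c -> -c.
*)
theory Submission
  imports Defs "HOL-Computational_Algebra.Polynomial"
begin

text \<open>The flux G replaces \<phi>' as the main unknown because \<phi>' is not controlled where
  \<phi> = rbar: D vanishes there, and a sharp profile may fail to be differentiable exactly at such
  a point. Below rbar the equation holds only almost everywhere, for an absolutely continuous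
  D(\<phi>) \<phi>'; a vanishing-derivative theorem turns it into a differentiable flux. That step
  divides by D(\<phi>), so \<phi> must also avoid 0: a monotone profile reaching 0 would stay there
  up to the end of its half-line, against g(0) > 0. The halving in (ii) comes from a balance of
  terms of equal size. While the gap stays between u/2 and u, a step of length C u^(1-\<alpha>)
  costs the flux a fixed multiple of C L u. This loss is at most K u, as q is Lipschitz, plus
  D(\<phi>) |\<phi>'| \<le> M u |\<phi>'|, as D is C^1 with D(rbar) = 0. Dividing by u bounds
  |\<phi>'| below by a constant, and since u \<le> u^(1-\<alpha>) for u \<le> 1, the profile would
  fall by at least u within the step, too much for a gap of at most u.\<close>

subsection \<open>Absolute continuity\<close>

text \<open>Fine tagged divisions: intervals tagged in the exceptional null set lie in an open set of small
  measure and are controlled by absolute continuity, the others by the vanishing derivative.\<close>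

lemma abs_continuous_on_zero_derivative:
  fixes F :: "real \<Rightarrow> real"
  assumes "a \<le> b" and ac: "abs_continuous_on {a..b} F"
    and ae: "AE x in lebesgue. x \<in> {a..b} \<longrightarrow> (F has_real_derivative 0) (at x)"
  shows "F b = F a"
proof -
  define N where "N = {x \<in> {a..b}. \<not> (F has_real_derivative 0) (at x)}"
  have neg: "negligible N"
  proof -
    have "AE x in lebesgue. x \<notin> N"
      using ae by (rule AE_mp) (auto simp: N_def)
    then obtain M where "{x. x \<in> N} \<subseteq> M" "M \<in> null_sets lebesgue"
      by (auto simp: eventually_ae_filter)
    then show ?thesis by (metis Collect_mem_eq negligible_iff_null_sets negligible_subset)
  qed
  have bound: "\<bar>F b - F a\<bar> \<le> e * (1 + (b - a))" if "e > 0" for e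
  proof -
    obtain \<delta> where "\<delta> > 0" and \<delta>: "\<And>d T. d division_of T \<Longrightarrow> T \<subseteq> {a..b} \<Longrightarrow>
        (\<Sum>k\<in>d. Sup k - Inf k) < \<delta> \<Longrightarrow> (\<Sum>k\<in>d. \<bar>F (Sup k) - F (Inf k)\<bar>) < e"
      using ac \<open>e > 0\<close> unfolding abs_continuous_on_def by meson
    have "N \<in> sets lebesgue"
      using neg by (simp add: negligible_imp_sets)
    then obtain U where U: "open U" "N \<subseteq> U" "U - N \<in> lmeasurable" "emeasure lebesgue (U - N) < ennreal \<delta>"
      using sets_lebesgue_outer_open[OF _ \<open>\<delta> > 0\<close>] by metis
    have Um: "U \<in> lmeasurable" "measure lebesgue U < \<delta>"
    proof -
      have "(U - N) \<union> N \<in> lmeasurable"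
        using U(3) neg by (blast intro: fmeasurable.Un negligible_imp_measurable)
      then show "U \<in> lmeasurable" using U(2) by (simp add: Un_absorb2)
      have "measure lebesgue U = measure lebesgue (U - N)"
        using neg U(1) by (simp add: measure_Diff_null_set negligible_iff_null_sets)
      also have "\<dots> < \<delta>"
        using U(3,4) \<open>\<delta> > 0\<close> by (simp add: emeasure_eq_measure2 ennreal_less_iff)
      finally show "measure lebesgue U < \<delta>" .
    qed
    have "\<exists>r>0. \<forall>y. \<bar>y - x\<bar> < r \<longrightarrow> \<bar>F y - F x\<bar> \<le> e * \<bar>y - x\<bar>" if "x \<in> {a..b} - N" for x
    proof -
      have "(F has_derivative (\<lambda>h. 0)) (at x)"
        using that by (auto simp: N_def has_field_derivative_def lambda_zero)
      then show ?thesis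
        unfolding has_derivative_at_alt using \<open>e > 0\<close> by (auto dest!: spec[of _ e])
    qed
    then obtain r where r: "\<And>x. x \<in> {a..b} - N \<Longrightarrow> r x > 0"
      "\<And>x y. x \<in> {a..b} - N \<Longrightarrow> \<bar>y - x\<bar> < r x \<Longrightarrow> \<bar>F y - F x\<bar> \<le> e * \<bar>y - x\<bar>"
      by metis
    define \<gamma> where "\<gamma> x = (if x \<in> N then U else if x \<in> {a..b} then ball x (r x) else ball x 1)" for x
    have "gauge \<gamma>"
      using U r(1) by (auto simp: gauge_def \<gamma>_def)
    then obtain p where p: "p tagged_division_of {a..b}" "\<gamma> fine p"
      using fine_division_exists_real by blast
    note fin = tagged_division_of_finite[OF p(1)]
    define q where "q = {xk \<in> p. fst xk \<in> N}"
    have cell: "\<exists>u v. k = {u..v} \<and> u \<le> v \<and> x \<in> {u..v} \<and> {u..v} \<subseteq> {a..b}" if xk: "(x, k) \<in> p" for x k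
    proof -
      obtain u v where "k = cbox u v" using tagged_division_ofD(4)[OF p(1) xk] by blast
      then show ?thesis
        using tagged_division_ofD(2,3)[OF p(1) xk] by (intro exI[of _ u] exI[of _ v]) auto
    qed
    have q: "q tagged_division_of \<Union>(snd ` q)"
      using p(1) tagged_partial_division_subset[of p "{a..b}" q]
      by (intro tagged_partial_division_of_Union_self[where s = "{a..b}"]) (auto simp: tagged_division_of_def q_def)
    have dq: "snd ` q division_of \<Union>(snd ` q)"
      using division_of_tagged_division[OF q] .
    have q_sub: "\<Union>(snd ` q) \<subseteq> {a..b}" "\<Union>(snd ` q) \<subseteq> U"
    proof -
      have "k \<subseteq> {a..b} \<and> k \<subseteq> U" if "(x, k) \<in> p" "x \<in> N" for x k
        using that cell[of x k] fineD[OF p(2) that(1)] by (auto simp: \<gamma>_def)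
      then show "\<Union>(snd ` q) \<subseteq> {a..b}" "\<Union>(snd ` q) \<subseteq> U" unfolding q_def by force+
    qed
    have cell_q: "\<exists>u v. k = {u..v} \<and> u \<le> v" if "k \<in> snd ` q" for k
      using that cell by (auto simp: q_def) blast
    have "(\<Sum>k\<in>snd ` q. Sup k - Inf k) = (\<Sum>k\<in>snd ` q. measure lebesgue k)"
    proof (rule sum.cong)
      fix k assume "k \<in> snd ` q"
      then obtain u v where "k = {u..v}" "u \<le> v" using cell_q by blast
      then show "Sup k - Inf k = measure lebesgue k" by simp
    qed simp
    also have "\<dots> = measure lebesgue (\<Union>(snd ` q))"
      using content_division[OF dq] by simp
    also have "\<dots> \<le> measure lebesgue U"
      by (rule measure_mono_fmeasurable[OF q_sub(2) fmeasurableD[OF lmeasurable_division[OF dq]] Um(1)])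
    also have "\<dots> < \<delta>" by (rule Um)
    finally have "(\<Sum>k\<in>snd ` q. \<bar>F (Sup k) - F (Inf k)\<bar>) < e"
      using \<delta>[OF dq q_sub(1)] by blast
    \<comment> \<open>Divisions are sets of intervals, whereas one interval may carry two tags. This
      happens only for a degenerate interval, which contributes 0.\<close>
    moreover have "(\<Sum>(x,k)\<in>q. \<bar>F (Sup k) - F (Inf k)\<bar>) = (\<Sum>k\<in>snd ` q. \<bar>F (Sup k) - F (Inf k)\<bar>)"
    proof -
      \<comment> \<open>\<open>Sup {}\<close> and \<open>Inf {}\<close> are unspecified reals that may differ\<close>
      define d where "d k = (if k = {} then 0 else \<bar>F (Sup k) - F (Inf k)\<bar>)" for k
      have "d (cbox u v) = 0" if "box u v = {}" for u v
        using that by (cases "u = v") (auto simp: d_def)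
      then have "(\<Sum>(x,k)\<in>q. d k) = (\<Sum>k\<in>snd ` q. d k)"
        by (rule sum.over_tagged_division_lemma[OF q])
      moreover have d: "d k = \<bar>F (Sup k) - F (Inf k)\<bar>" if "k \<in> snd ` q" for k
        using cell_q[OF that] by (auto simp: d_def)
      moreover have "(\<Sum>(x,k)\<in>q. d k) = (\<Sum>(x,k)\<in>q. \<bar>F (Sup k) - F (Inf k)\<bar>)"
        by (rule sum.cong) (auto intro!: d rev_image_eqI)
      ultimately show ?thesis by simp
    qed
    ultimately have bad: "(\<Sum>(x,k)\<in>q. \<bar>F (Sup k) - F (Inf k)\<bar>) < e" by simp
    have good: "(\<Sum>(x,k)\<in>p - q. \<bar>F (Sup k) - F (Inf k)\<bar>) \<le> (\<Sum>(x,k)\<in>p - q. e * measure lborel k)"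
    proof (rule sum_mono, clarify)
      fix x k assume xk: "(x, k) \<in> p" "(x, k) \<notin> q"
      then obtain u v where uv: "k = {u..v}" "u \<le> v" "x \<in> {u..v}" "{u..v} \<subseteq> {a..b}" using cell by blast
      have x: "x \<in> {a..b} - N" using xk uv by (auto simp: q_def)
      have "{u..v} \<subseteq> ball x (r x)" using fineD[OF p(2) xk(1)] x uv by (simp add: \<gamma>_def)
      then have "u \<in> ball x (r x)" "v \<in> ball x (r x)" using uv by (auto simp del: mem_ball)
      then have "\<bar>F u - F x\<bar> \<le> e * \<bar>u - x\<bar>" "\<bar>F v - F x\<bar> \<le> e * \<bar>v - x\<bar>"
        using r(2)[OF x] by (auto simp: dist_real_def abs_minus_commute)
      then have "\<bar>F v - F u\<bar> \<le> e * \<bar>u - x\<bar> + e * \<bar>v - x\<bar>" by linarith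
      \<comment> \<open>Straddle estimate: the tag lies between u and v, so the two distances add up
        to the length.\<close>
      also have "\<dots> = e * (v - u)" using uv by (simp add: algebra_simps)
      finally show "\<bar>F (Sup k) - F (Inf k)\<bar> \<le> e * measure lborel k" using uv by simp
    qed
    have "(\<Sum>(x,k)\<in>p - q. e * measure lborel k) \<le> (\<Sum>(x,k)\<in>p. e * measure lborel k)"
      using fin \<open>e > 0\<close> by (intro sum_mono2) auto
    also have "\<dots> = e * (b - a)"
      using additive_content_tagged_division[of p a b] p(1) \<open>a \<le> b\<close>
      by (simp add: sum_distrib_left[symmetric] case_prod_unfold)
    finally have good': "(\<Sum>(x,k)\<in>p - q. \<bar>F (Sup k) - F (Inf k)\<bar>) \<le> e * (b - a)" using good by linarith
    have "F b - F a = (\<Sum>(x,k)\<in>p. F (Sup k) - F (Inf k))"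
      using additive_tagged_division_1[OF \<open>a \<le> b\<close> p(1), of F] by simp
    then have "\<bar>F b - F a\<bar> \<le> (\<Sum>(x,k)\<in>p. \<bar>F (Sup k) - F (Inf k)\<bar>)"
      using sum_abs[of "\<lambda>(x,k). F (Sup k) - F (Inf k)" p] by (simp add: case_prod_unfold)
    also have "\<dots> = (\<Sum>(x,k)\<in>p - q. \<bar>F (Sup k) - F (Inf k)\<bar>) + (\<Sum>(x,k)\<in>q. \<bar>F (Sup k) - F (Inf k)\<bar>)"
      using fin by (intro sum.subset_diff) (auto simp: q_def)
    also have "\<dots> \<le> e * (1 + (b - a))" using bad good' by (simp add: algebra_simps)
    finally show ?thesis .
  qed
  have "\<bar>F b - F a\<bar> \<le> 0"
  proof (rule field_le_epsilon)
    fix e :: real assume "e > 0"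
    then show "\<bar>F b - F a\<bar> \<le> 0 + e"
      using bound[of "e / (1 + (b - a))"] \<open>a \<le> b\<close> by (simp add: divide_simps)
  qed
  then show ?thesis by simp
qed

lemma abs_continuous_on_add:
  assumes "abs_continuous_on S F" "abs_continuous_on S G"
  shows "abs_continuous_on S (\<lambda>x. F x + G x)"
  unfolding abs_continuous_on_def
proof (intro allI impI)
  fix e :: real assume "e > 0"
  then have e2: "e / 2 > 0" by simp
  obtain d1 where d1: "d1 > 0" "\<And>d T. d division_of T \<Longrightarrow> T \<subseteq> S \<Longrightarrow>
        (\<Sum>k\<in>d. Sup k - Inf k) < d1 \<Longrightarrow> (\<Sum>k\<in>d. \<bar>F (Sup k) - F (Inf k)\<bar>) < e / 2"
    using assms(1) e2 unfolding abs_continuous_on_def by meson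
  obtain d2 where d2: "d2 > 0" "\<And>d T. d division_of T \<Longrightarrow> T \<subseteq> S \<Longrightarrow>
        (\<Sum>k\<in>d. Sup k - Inf k) < d2 \<Longrightarrow> (\<Sum>k\<in>d. \<bar>G (Sup k) - G (Inf k)\<bar>) < e / 2"
    using assms(2) e2 unfolding abs_continuous_on_def by meson
  show "\<exists>\<delta>>0. \<forall>d T. d division_of T \<and> T \<subseteq> S \<and> (\<Sum>k\<in>d. Sup k - Inf k) < \<delta> \<longrightarrow>
        (\<Sum>k\<in>d. \<bar>F (Sup k) + G (Sup k) - (F (Inf k) + G (Inf k))\<bar>) < e"
  proof (intro exI[of _ "min d1 d2"] conjI allI impI)
    fix d T assume *: "d division_of T \<and> T \<subseteq> S \<and> (\<Sum>k\<in>d. Sup k - Inf k) < min d1 d2"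
    have "(\<Sum>k\<in>d. \<bar>F (Sup k) + G (Sup k) - (F (Inf k) + G (Inf k))\<bar>)
        \<le> (\<Sum>k\<in>d. \<bar>F (Sup k) - F (Inf k)\<bar> + \<bar>G (Sup k) - G (Inf k)\<bar>)"
      by (intro sum_mono) linarith
    also have "\<dots> < e"
      using d1(2)[of d T] d2(2)[of d T] * by (simp add: sum.distrib)
    finally show "(\<Sum>k\<in>d. \<bar>F (Sup k) + G (Sup k) - (F (Inf k) + G (Inf k))\<bar>) < e" .
  qed (use d1(1) d2(1) in auto)
qed

lemma lipschitz_on_imp_abs_continuous_on:
  fixes F :: "real \<Rightarrow> real"
  assumes "K-lipschitz_on S F"
  shows "abs_continuous_on S F"
  unfolding abs_continuous_on_def
proof (intro allI impI)
  fix e :: real assume "e > 0"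
  have K: "K \<ge> 0" using assms by (rule lipschitz_on_nonneg)
  show "\<exists>\<delta>>0. \<forall>d T. d division_of T \<and> T \<subseteq> S \<and> (\<Sum>k\<in>d. Sup k - Inf k) < \<delta> \<longrightarrow>
        (\<Sum>k\<in>d. \<bar>F (Sup k) - F (Inf k)\<bar>) < e"
  \<comment> \<open>K may be 0, hence the denominator K + 1.\<close>
  proof (intro exI[of _ "e / (K + 1)"] conjI allI impI)
    fix d T assume *: "d division_of T \<and> T \<subseteq> S \<and> (\<Sum>k\<in>d. Sup k - Inf k) < e / (K + 1)"
    have uv: "\<exists>u v. k = {u..v} \<and> u \<le> v \<and> u \<in> S \<and> v \<in> S" if k: "k \<in> d" for k
    proof -
      have dT: "d division_of T" "T \<subseteq> S" using * by auto
      obtain u v where "k = cbox u v" using division_ofD(4)[OF dT(1) k] by blast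
      then show ?thesis
        using division_ofD(2,3)[OF dT(1) k] dT(2) by (intro exI[of _ u] exI[of _ v]) auto
    qed
    have 1: "(\<Sum>k\<in>d. \<bar>F (Sup k) - F (Inf k)\<bar>) \<le> (\<Sum>k\<in>d. K * (Sup k - Inf k))"
    proof (rule sum_mono)
      fix k assume "k \<in> d"
      then obtain u v where "k = {u..v}" "u \<le> v" "u \<in> S" "v \<in> S" using uv by blast
      then show "\<bar>F (Sup k) - F (Inf k)\<bar> \<le> K * (Sup k - Inf k)"
        using lipschitz_onD[OF assms, of v u] by (simp add: dist_real_def)
    qed
    have "0 \<le> (\<Sum>k\<in>d. Sup k - Inf k)"
      using uv by (intro sum_nonneg) fastforce
    then have "(\<Sum>k\<in>d. K * (Sup k - Inf k)) \<le> (K + 1) * (\<Sum>k\<in>d. Sup k - Inf k)"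
      by (simp add: sum_distrib_left[symmetric] distrib_right)
    also have "\<dots> < e" using * K by (simp add: field_simps)
    finally show "(\<Sum>k\<in>d. \<bar>F (Sup k) - F (Inf k)\<bar>) < e" using 1 by linarith
  qed (use K \<open>e > 0\<close> in auto)
qed

text \<open>A single interval is already an admissible division. Applied to D(\<phi>) \<phi>', this
  later yields continuity of \<phi>'.\<close>

lemma abs_continuous_on_imp_continuous_on:
  assumes "abs_continuous_on {a..b} F"
  shows "continuous_on {a..b} F"
  unfolding continuous_on_iff
proof (intro ballI allI impI)
  fix x e :: real assume x: "x \<in> {a..b}" and "e > 0"
  then obtain \<delta> where \<delta>: "\<delta> > 0" "\<And>d T. d division_of T \<Longrightarrow> T \<subseteq> {a..b} \<Longrightarrow>
        (\<Sum>k\<in>d. Sup k - Inf k) < \<delta> \<Longrightarrow> (\<Sum>k\<in>d. \<bar>F (Sup k) - F (Inf k)\<bar>) < e"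
    using assms unfolding abs_continuous_on_def by meson
  have *: "\<bar>F v - F u\<bar> < e" if "u \<in> {a..b}" "v \<in> {a..b}" "u \<le> v" "v - u < \<delta>" for u v
  proof -
    have "{{u..v}} division_of {u..v}" using that division_of_self[of u v] by simp
    then show ?thesis using that \<delta>(2)[of "{{u..v}}" "{u..v}"] by simp
  qed
  show "\<exists>d>0. \<forall>y\<in>{a..b}. dist y x < d \<longrightarrow> dist (F y) (F x) < e"
  proof (intro exI[of _ \<delta>] conjI ballI impI \<delta>)
    fix y assume "y \<in> {a..b}" "dist y x < \<delta>"
    then show "dist (F y) (F x) < e"
      using *[of x y] *[of y x] x by (cases "x \<le> y") (auto simp: dist_real_def abs_minus_commute)
  qed
qed

subsection \<open>A smooth bump function\<close>

text \<open>Order n asks that the derivatives up to order n be differentiable themselves, so order 0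
  is plain differentiability. A finite order lets the product rule be used inductively: one order is
  spent on each differentiation.\<close>

definition n_times_differentiable :: "nat \<Rightarrow> (real \<Rightarrow> real) \<Rightarrow> bool" where
  "n_times_differentiable n f \<longleftrightarrow> (\<forall>k\<le>n. \<forall>x. (deriv ^^ k) f differentiable (at x))"

lemma n_times_differentiable_0: "n_times_differentiable 0 f \<longleftrightarrow> (\<forall>x. f differentiable (at x))"
  by (simp add: n_times_differentiable_def)

lemma n_times_differentiable_Suc:
  "n_times_differentiable (Suc n) f \<longleftrightarrow> (\<forall>x. f differentiable (at x)) \<and> n_times_differentiable n (deriv f)"
proof -
  have "(\<forall>k\<le>Suc n. P k) \<longleftrightarrow> P 0 \<and> (\<forall>k\<le>n. P (Suc k))" for P :: "nat \<Rightarrow> bool"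
    by (metis Suc_le_mono le0 old.nat.exhaust)
  note this[of "\<lambda>k. \<forall>x. (deriv ^^ k) f differentiable (at x)"]
  then show ?thesis
    unfolding n_times_differentiable_def by (simp add: funpow_Suc_right del: funpow.simps(2))
qed

lemma n_times_differentiable_mono:
  "n_times_differentiable n f \<Longrightarrow> m \<le> n \<Longrightarrow> n_times_differentiable m f"
  by (auto simp: n_times_differentiable_def)

lemma n_times_differentiable_DERIV:
  "n_times_differentiable n f \<Longrightarrow> (f has_real_derivative deriv f x) (at x)"
  by (auto simp: n_times_differentiable_def DERIV_deriv_iff_real_differentiable dest: spec[of _ 0])

lemma n_times_differentiable_add:
  "n_times_differentiable n f \<Longrightarrow> n_times_differentiable n g \<Longrightarrow> n_times_differentiable n (\<lambda>x. f x + g x)"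
proof (induction n arbitrary: f g)
  case (Suc n)
  have "deriv (\<lambda>x. f x + g x) = (\<lambda>x. deriv f x + deriv g x)"
    using Suc.prems by (intro ext DERIV_imp_deriv DERIV_add n_times_differentiable_DERIV)
  with Suc show ?case by (auto simp: n_times_differentiable_Suc)
qed (auto simp: n_times_differentiable_0)

lemma n_times_differentiable_mult:
  "n_times_differentiable n f \<Longrightarrow> n_times_differentiable n g \<Longrightarrow> n_times_differentiable n (\<lambda>x. f x * g x)"
proof (induction n arbitrary: f g)
  case (Suc n)
  have "deriv (\<lambda>x. f x * g x) = (\<lambda>x. f x * deriv g x + deriv f x * g x)"
    using Suc.prems by (intro ext DERIV_imp_deriv DERIV_mult' n_times_differentiable_DERIV)
  moreover have "n_times_differentiable n f" "n_times_differentiable n g"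
    using Suc.prems by (auto intro: n_times_differentiable_mono)
  ultimately show ?case
    using Suc by (auto simp: n_times_differentiable_Suc intro!: n_times_differentiable_add)
qed (auto simp: n_times_differentiable_0)

lemma n_times_differentiable_const: "n_times_differentiable n (\<lambda>x. s)"
proof (induction n arbitrary: s)
  case (Suc n)
  have "deriv (\<lambda>x. s) = (\<lambda>x. 0)" by (intro ext) simp
  with Suc show ?case by (simp add: n_times_differentiable_Suc)
qed (simp add: n_times_differentiable_0)

lemma n_times_differentiable_affine:
  "n_times_differentiable n f \<Longrightarrow> n_times_differentiable n (\<lambda>x. f (s * x + b))"
proof (induction n arbitrary: f)
  case 0
  have "((\<lambda>x. f (s * x + b)) has_real_derivative deriv f (s * x + b) * s) (at x)" for x
    by (rule DERIV_chain2[OF n_times_differentiable_DERIV[OF 0]]) (auto intro!: derivative_eq_intros)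
  then show ?case by (auto simp: n_times_differentiable_0 real_differentiable_def)
next
  case (Suc n)
  have d: "((\<lambda>x. f (s * x + b)) has_real_derivative deriv f (s * x + b) * s) (at x)" for x
    by (rule DERIV_chain2[OF n_times_differentiable_DERIV[OF Suc.prems]]) (auto intro!: derivative_eq_intros)
  then have "deriv (\<lambda>x. f (s * x + b)) = (\<lambda>x. deriv f (s * x + b) * s)"
    by (intro ext DERIV_imp_deriv)
  moreover have "n_times_differentiable n (\<lambda>x. deriv f (s * x + b) * s)"
    using Suc by (intro n_times_differentiable_mult n_times_differentiable_const)
      (auto simp: n_times_differentiable_Suc)
  ultimately show ?case
    using d by (auto simp: n_times_differentiable_Suc real_differentiable_def)
qed

text \<open>For p = 1 this is the classical smooth function exp(-1/x), continued by 0. The factor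
  p(1/x) makes the family closed under differentiation, so one induction over all p gives
  smoothness.\<close>

definition flat_exp :: "real poly \<Rightarrow> real \<Rightarrow> real" where
  "flat_exp p x = (if x > 0 then poly p (1 / x) * exp (- (1 / x)) else 0)"

lemma poly_times_exp_minus_tendsto_0:
  "((\<lambda>y. poly p y * exp (- y)) \<longlongrightarrow> (0::real)) at_top"
proof -
  have "((\<lambda>y. \<Sum>i\<le>degree p. coeff p i * (y ^ i / exp y)) \<longlongrightarrow> (\<Sum>i\<le>degree p. coeff p i * 0)) at_top"
    by (intro tendsto_intros tendsto_power_div_exp_0)
  then show ?thesis
    by (simp add: poly_altdef sum_distrib_right exp_minus divide_inverse mult.assoc)
qed

lemma flat_exp_tendsto_0: "(flat_exp p \<longlongrightarrow> 0) (at 0)"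
proof (rule filterlim_split_at)
  show "(flat_exp p \<longlongrightarrow> 0) (at_left 0)"
    by (rule tendsto_eventually) (auto simp: flat_exp_def eventually_at_filter)
  have "((\<lambda>x. poly p (1 / x) * exp (- (1 / x))) \<longlongrightarrow> 0) (at_right 0)"
    using filterlim_compose[OF poly_times_exp_minus_tendsto_0 filterlim_inverse_at_top_right, of p]
    by (simp add: inverse_eq_divide)
  then show "(flat_exp p \<longlongrightarrow> 0) (at_right 0)"
    by (rule Lim_transform_eventually) (auto simp: flat_exp_def eventually_at_filter)
qed

text \<open>With y = 1/x, the derivative of p(y) exp(-y) in x is y^2 (p(y) - p'(y)) exp(-y), which
  gives the new polynomial.\<close>

lemma flat_exp_has_derivative:
  "(flat_exp p has_real_derivative flat_exp (monom 1 2 * (p - pderiv p)) x) (at x)"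
proof -
  consider "x > 0" | "x = 0" | "x < 0" by linarith
  then show ?thesis
  proof cases
    case 1
    have "((\<lambda>x. poly p (1 / x) * exp (- (1 / x))) has_real_derivative flat_exp (monom 1 2 * (p - pderiv p)) x) (at x)"
      using 1 by (auto intro!: derivative_eq_intros DERIV_chain2[OF poly_DERIV]
        simp: flat_exp_def poly_monom field_simps power2_eq_square)
    then show ?thesis
      by (rule has_field_derivative_transform_within_open[of _ _ _ "{0<..}"]) (use 1 in \<open>auto simp: flat_exp_def\<close>)
  next
    case 2
    \<comment> \<open>Dividing by h multiplies the polynomial by y = 1/h, and
      \<open>pCons 0 p\<close> is y p(y); the quotient is again a flat exponential.\<close>
    have "((\<lambda>h. (flat_exp p (0 + h) - flat_exp p 0) / h) \<longlongrightarrow> 0) (at 0)"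
      by (rule Lim_transform_eventually[OF flat_exp_tendsto_0[of "pCons 0 p"]])
        (auto simp: flat_exp_def eventually_at_filter)
    then show ?thesis using 2 by (simp add: DERIV_def flat_exp_def)
  next
    case 3
    have "((\<lambda>x. 0) has_real_derivative 0) (at x)" by simp
    then show ?thesis
      using 3 has_field_derivative_transform_within_open[of "\<lambda>x. 0" 0 x "{..<0}" "flat_exp p"]
      by (auto simp: flat_exp_def)
  qed
qed

lemma n_times_differentiable_flat_exp: "n_times_differentiable n (flat_exp p)"
proof (induction n arbitrary: p)
  case (Suc n)
  have "deriv (flat_exp p) = flat_exp (monom 1 2 * (p - pderiv p))"
    by (intro ext DERIV_imp_deriv flat_exp_has_derivative)
  then show ?case
    using Suc flat_exp_has_derivative by (auto simp: n_times_differentiable_Suc real_differentiable_def)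
qed (use flat_exp_has_derivative in \<open>auto simp: n_times_differentiable_0 real_differentiable_def\<close>)

lemma test_function_exists:
  fixes a r :: real
  assumes "r > 0" "{a - r..a + r} \<subseteq> I"
  obtains \<psi> where "test_function I \<psi>" "\<psi> a > 0" "\<And>x. x \<notin> {a - r<..<a + r} \<Longrightarrow> \<psi> x = 0"
proof -
  \<comment> \<open>The first factor vanishes for x \<le> a - r, the second for x \<ge> a + r. The
    affine arguments are spelled out with coefficients 1 and -1 to match
    \<open>n_times_differentiable_affine\<close>.\<close>
  define \<psi> where "\<psi> x = flat_exp 1 (1 * x + (r - a)) * flat_exp 1 (- 1 * x + (a + r))" for x
  have outside: "\<psi> x = 0" if "x \<notin> {a - r<..<a + r}" for x
    using that by (auto simp: \<psi>_def flat_exp_def)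
  have diff: "n_times_differentiable n \<psi>" for n
    unfolding \<psi>_def
    by (intro n_times_differentiable_mult n_times_differentiable_affine n_times_differentiable_flat_exp)
  have supp: "closure {x. \<psi> x \<noteq> 0} \<subseteq> {a - r..a + r}"
  proof (rule closure_minimal)
    show "{x. \<psi> x \<noteq> 0} \<subseteq> {a - r..a + r}"
    proof
      fix x assume "x \<in> {x. \<psi> x \<noteq> 0}"
      then show "x \<in> {a - r..a + r}" using outside[of x] by (cases "x \<in> {a - r<..<a + r}") auto
    qed
  qed simp
  have "compact (closure {x. \<psi> x \<noteq> 0})"
    using supp by (meson bounded_closed_interval bounded_subset closed_closure compact_eq_bounded_closed)
  moreover have "(deriv ^^ n) \<psi> differentiable (at x)" for n x
    using diff[of n] by (simp add: n_times_differentiable_def)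
  ultimately have "test_function I \<psi>"
    using supp assms(2) by (auto simp: test_function_def)
  moreover have "\<psi> a > 0" using assms(1) by (simp add: \<psi>_def flat_exp_def)
  ultimately show thesis using outside by (rule that)
qed

subsection \<open>Weak and classical solutions\<close>

text \<open>The integrand is the derivative of the product of G and \<psi>, because G' = -k.
  Absolute integrability comes along since the weak formulation is a Lebesgue integral, while the
  fundamental theorem concerns the gauge integral.\<close>

lemma flux_test_has_integral:
  fixes G k \<psi> :: "real \<Rightarrow> real"
  assumes "s \<le> t" and "continuous_on {s..t} G" and "continuous_on {s..t} k"
    and G: "\<And>x. x \<in> {s<..<t} \<Longrightarrow> (G has_real_derivative - k x) (at x)"
    and \<psi>: "test_function I \<psi>"
  shows "(\<lambda>x. G x * deriv \<psi> x - k x * \<psi> x) absolutely_integrable_on {s..t}"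
    and "((\<lambda>x. G x * deriv \<psi> x - k x * \<psi> x) has_integral (G t * \<psi> t - G s * \<psi> s)) {s..t}"
proof -
  have "(deriv ^^ n) \<psi> differentiable (at x)" for n x
    using \<psi> by (simp add: test_function_def)
  from this[of 0] this[of 1]
  have d: "(\<psi> has_real_derivative deriv \<psi> x) (at x)" "isCont (deriv \<psi>) x" for x
    by (auto simp: DERIV_deriv_iff_real_differentiable differentiable_imp_continuous_within)
  have c: "continuous_on {s..t} \<psi>" "continuous_on {s..t} (deriv \<psi>)"
    using d by (auto intro!: continuous_at_imp_continuous_on DERIV_isCont[OF d(1)])
  show "(\<lambda>x. G x * deriv \<psi> x - k x * \<psi> x) absolutely_integrable_on {s..t}"
    by (intro absolutely_integrable_continuous_real continuous_intros assms c)
  show "((\<lambda>x. G x * deriv \<psi> x - k x * \<psi> x) has_integral (G t * \<psi> t - G s * \<psi> s)) {s..t}"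
  proof (rule fundamental_theorem_of_calculus_interior)
    fix x assume x: "x \<in> {s<..<t}"
    show "((\<lambda>x. G x * \<psi> x) has_vector_derivative G x * deriv \<psi> x - k x * \<psi> x) (at x)"
      using DERIV_mult'[OF G[OF x] d(1)[of x]]
      by (simp add: has_real_derivative_iff_has_vector_derivative)
  qed (intro continuous_intros assms c)+
qed

text \<open>For a bump \<psi> around a, integration by parts on both sides of a leaves (Gl - Gr)
  \<psi>(a), the terms at a - r and a + r being 0. The weak identity makes this vanish although
  \<psi>(a) > 0.\<close>

lemma weak_solution_no_jump:
  fixes G k :: "real \<Rightarrow> real"
  assumes "r > 0" and sub: "{a - r..a + r} \<subseteq> I" and "open I" and k: "continuous_on I k"
    and weak: "\<And>\<psi>. test_function I \<psi> \<Longrightarrow> (LINT x:I|lebesgue. G x * deriv \<psi> x - k x * \<psi> x) = 0"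
    and G: "\<And>x. x \<in> {a - r..a + r} \<Longrightarrow> x \<noteq> a \<Longrightarrow> (G has_real_derivative - k x) (at x)"
    and Gl: "(G \<longlongrightarrow> Gl) (at_left a)" and Gr: "(G \<longlongrightarrow> Gr) (at_right a)"
  shows "Gl = Gr"
proof -
  obtain \<psi> where \<psi>: "test_function I \<psi>" "\<psi> a > 0" "\<And>x. x \<notin> {a - r<..<a + r} \<Longrightarrow> \<psi> x = 0"
    using test_function_exists[OF \<open>r > 0\<close> sub] by blast
  define F where "F H x = H x * deriv \<psi> x - k x * \<psi> x" for H x
  have ends: "\<psi> (a - r) = 0" "\<psi> (a + r) = 0" using \<psi>(3) by auto
  \<comment> \<open>The value of G at a is uncontrolled. Replacing it by a one-sided limit gives a
    function continuous up to a on that side.\<close>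
  have ext: "continuous_on {s..t} (G(a := l))" "\<And>x. x \<in> {s<..<t} \<Longrightarrow> (G(a := l) has_real_derivative - k x) (at x)"
    if st: "s < t" "{s..t} \<subseteq> {a - r..a + r}" "t = a \<and> (G \<longlongrightarrow> l) (at_left a) \<or> s = a \<and> (G \<longlongrightarrow> l) (at_right a)" for s t l
  proof -
    have D: "(G(a := l) has_real_derivative - k x) (at x)" if x: "x \<in> {a - r..a + r}" "x \<noteq> a" for x
      by (rule has_field_derivative_transform_within_open[OF G[OF x], of "- {a}"]) (use x in auto)
    show "(G(a := l) has_real_derivative - k x) (at x)" if "x \<in> {s<..<t}" for x
      using st that by (intro D) auto
    show "continuous_on {s..t} (G(a := l))"
      unfolding continuous_on_eq_continuous_within
    proof
      fix x assume x: "x \<in> {s..t}"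
      show "continuous (at x within {s..t}) (G(a := l))"
      proof (cases "x = a")
        case False
        then show ?thesis using x st DERIV_isCont[OF D, of x] continuous_at_imp_continuous_at_within by blast
      next
        case True
        have "(G \<longlongrightarrow> l) (at a within {s..t})"
          using st(1,3) at_within_Icc_at_left[of s t] at_within_Icc_at_right[of s t] by auto
        then have "(G(a := l) \<longlongrightarrow> l) (at a within {s..t})"
          by (rule Lim_transform_eventually) (auto simp: eventually_at_filter)
        then show ?thesis by (simp add: continuous_within True)
      qed
    qed
  qed
  have kc: "continuous_on {a - r..a} k" "continuous_on {a..a + r} k"
    using sub \<open>r > 0\<close> by (auto intro!: continuous_on_subset[OF k])
  have l: "F (G(a := Gl)) absolutely_integrable_on {a - r..a}"
    "(F (G(a := Gl)) has_integral Gl * \<psi> a) {a - r..a}"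
    using flux_test_has_integral[of "a - r" a "G(a := Gl)" k I \<psi>] ext[of "a - r" a Gl] Gl ends \<open>r > 0\<close>
      kc \<psi>(1) unfolding F_def by auto
  have r: "F (G(a := Gr)) absolutely_integrable_on {a..a + r}"
    "(F (G(a := Gr)) has_integral - Gr * \<psi> a) {a..a + r}"
    using flux_test_has_integral[of a "a + r" "G(a := Gr)" k I \<psi>] ext[of a "a + r" Gr] Gr ends \<open>r > 0\<close>
      kc \<psi>(1) unfolding F_def by auto
  \<comment> \<open>Back to G itself: only the value at the single point a changes.\<close>
  have l': "F G absolutely_integrable_on {a - r..a}" "(F G has_integral Gl * \<psi> a) {a - r..a}"
    by (rule absolutely_integrable_spike[OF l(1), of "{a}"] has_integral_spike[OF _ _ l(2), of "{a}"];
        simp add: F_def)+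
  have r': "F G absolutely_integrable_on {a..a + r}" "(F G has_integral - Gr * \<psi> a) {a..a + r}"
    by (rule absolutely_integrable_spike[OF r(1), of "{a}"] has_integral_spike[OF _ _ r(2), of "{a}"];
        simp add: F_def)+
  \<comment> \<open>The Lebesgue integral of a non-integrable function is 0 by default, so the weak
    identity carries information only after integrability over I is established.\<close>
  have "F G absolutely_integrable_on {a - r..a + r}"
    using absolutely_integrable_on_combine[OF l'(1) r'(1)] \<open>r > 0\<close> by simp
  moreover have 1: "(F G has_integral Gl * \<psi> a - Gr * \<psi> a) {a - r..a + r}"
    using has_integral_combine[OF _ _ l'(2) r'(2)] \<open>r > 0\<close> by simp
  moreover have outside: "F G x = 0" if "x \<notin> {a - r..a + r}" for x
  proof -
    have "((\<lambda>x. 0) has_real_derivative 0) (at x)" by simp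
    then have "(\<psi> has_real_derivative 0) (at x)"
      by (rule has_field_derivative_transform_within_open[of _ _ _ "- {a - r..a + r}"])
        (use that \<psi>(3) in \<open>auto intro!: open_Compl\<close>)
    then show ?thesis using \<psi>(3)[of x] that by (auto simp: F_def DERIV_imp_deriv)
  qed
  moreover have "{x \<in> I - {a - r..a + r}. F G x \<noteq> 0} = {}" "{x \<in> {a - r..a + r} - I. F G x \<noteq> 0} = {}"
    using outside sub by blast+
  then have "negligible {x \<in> I - {a - r..a + r}. F G x \<noteq> 0}" "negligible {x \<in> {a - r..a + r} - I. F G x \<noteq> 0}"
    by (simp_all only: negligible_empty)
  ultimately have "F G absolutely_integrable_on I"
    using absolutely_integrable_spike_set_eq by blast
  then have "(F G has_integral 0) I"
    using has_integral_set_lebesgue[of I "F G"] weak[OF \<psi>(1)] by (simp add: F_def)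
  moreover have "(F G has_integral Gl * \<psi> a - Gr * \<psi> a) I"
    using has_integral_on_superset[OF 1 outside sub] .
  ultimately have "Gl * \<psi> a - Gr * \<psi> a = 0" by (metis has_integral_unique)
  then show ?thesis using \<psi>(2) by (simp add: left_diff_distrib[symmetric])
qed

text \<open>Where \<phi> is constant both derivative terms vanish and the equation leaves g(k) = 0
  almost everywhere; a nonempty open interval is not a null set.\<close>

lemma classical_on_not_locally_constant:
  assumes cl: "classical_on D h g c S \<phi>" and "{s<..<t} \<subseteq> S" "s < t"
    and const: "\<And>x. x \<in> {s<..<t} \<Longrightarrow> \<phi> x = k"
  shows "g k = 0"
proof (rule ccontr)
  assume "g k \<noteq> 0"
  have d0: "deriv \<phi> x = 0" if "x \<in> {s<..<t}" for x
    using has_field_derivative_transform_within_open[of "\<lambda>x. k" 0 x "{s<..<t}" \<phi>] that const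
    by (auto intro!: DERIV_imp_deriv)
  then have "deriv (\<lambda>x. D (\<phi> x) * deriv \<phi> x) x = 0" if "x \<in> {s<..<t}" for x
    using has_field_derivative_transform_within_open[of "\<lambda>x. 0" 0 x "{s<..<t}" "\<lambda>x. D (\<phi> x) * deriv \<phi> x"] that
    by (auto intro!: DERIV_imp_deriv)
  moreover have "AE x in lebesgue. x \<in> S \<longrightarrow>
      deriv (\<lambda>\<zeta>. D (\<phi> \<zeta>) * deriv \<phi> \<zeta>) x + (c - h (\<phi> x)) * deriv \<phi> x + g (\<phi> x) = 0"
    using cl unfolding classical_on_def by (auto elim: eventually_mono)
  ultimately have "AE x in lebesgue. x \<notin> {s<..<t}"
    using d0 const \<open>g k \<noteq> 0\<close> \<open>{s<..<t} \<subseteq> S\<close> by (auto elim!: eventually_mono)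
  then have "{s<..<t} \<in> null_sets lebesgue"
    by (simp add: completion.AE_iff_null_sets greaterThanLessThan_eq greaterThan_def lessThan_def Int_def)
  then show False using \<open>s < t\<close> by (auto simp: null_sets_def)
qed

section \<open>From the almost-everywhere equation to a differentiable flux\<close>

lemma continuous_derivative_lipschitz:
  fixes F :: "real \<Rightarrow> real"
  assumes "\<And>x. x \<in> {a..b} \<Longrightarrow> (F has_real_derivative F' x) (at x within {a..b})"
    and "continuous_on {a..b} F'"
  obtains K where "K > 0" "K-lipschitz_on {a..b} F"
proof -
  have "bounded (F' ` {a..b})"
    using assms(2) by (intro compact_imp_bounded compact_continuous_image) auto
  then obtain K where K: "K > 0" "\<And>x. x \<in> {a..b} \<Longrightarrow> norm (F' x) \<le> K"
    by (auto simp: bounded_pos)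
  have "K-lipschitz_on {a..b} F"
    by (rule lipschitz_onI)
      (use field_differentiable_bound[of "{a..b}" F F' K] assms(1) K in \<open>auto simp: dist_norm\<close>)
  then show thesis using K(1) by (intro that)
qed

text \<open>Since D(\<phi>) > 0, \<phi>' is the quotient of the continuous function P by D(\<phi>),
  hence continuous. The lower-order terms then have a Lipschitz primitive R, and P + R is absolutely
  continuous with derivative 0 almost everywhere, hence constant. Thus G is a constant minus a
  primitive of the continuous g(\<phi>), which is differentiable everywhere.\<close>

lemma classical_flux_derivative:
  fixes f h D g \<phi> :: "real \<Rightarrow> real" and c :: real
  defines "G \<equiv> \<lambda>\<xi>. D (\<phi> \<xi>) * deriv \<phi> \<xi> - f (\<phi> \<xi>) + c * \<phi> \<xi>"
  assumes f: "\<And>r. r \<in> {0..rbar} \<Longrightarrow> (f has_real_derivative h r) (at r within {0..rbar})"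
    and h: "continuous_on {0..rbar} h" and D: "continuous_on {0..rbar} D"
    and Dpos: "\<And>r. r \<in> {0<..<rbar} \<Longrightarrow> D r > 0" and g: "continuous_on {0..rbar} g"
    and cl: "classical_on D h g c S \<phi>"
    and U: "open U" "U \<subseteq> S" "\<And>x. x \<in> U \<Longrightarrow> \<phi> x \<in> {0<..<rbar}" and "x \<in> U"
  shows "(G has_real_derivative - g (\<phi> x)) (at x)"
proof -
  define P where "P \<xi> = D (\<phi> \<xi>) * deriv \<phi> \<xi>" for \<xi>
  obtain e where "e > 0" and e: "cball x e \<subseteq> U"
    using U(1) \<open>x \<in> U\<close> by (auto simp: open_contains_cball)
  define a b where "a = x - e" and "b = x + e"
  have ab: "a < x" "x < b" "{a..b} \<subseteq> U"
    using e \<open>e > 0\<close> by (auto simp: a_def b_def cball_eq_atLeastAtMost)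
  have \<phi>: "(\<phi> has_real_derivative deriv \<phi> y) (at y)" if "y \<in> {a..b}" for y
  proof -
    have "y \<in> S" using that ab(3) U(2) by blast
    then show ?thesis using cl by (simp add: classical_on_def DERIV_deriv_iff_real_differentiable)
  qed
  have \<phi>c: "continuous_on {a..b} \<phi>"
    using \<phi> DERIV_isCont by (blast intro: continuous_at_imp_continuous_on)
  have im: "\<phi> ` {a..b} \<subseteq> {0..rbar}" using U(3) ab(3) by force
  note comp = continuous_on_compose2[OF _ \<phi>c im]
  have ac: "abs_continuous_on {s..t} P" if "{s..t} \<subseteq> {a..b}" for s t
    using cl that ab(3) U(2) unfolding classical_on_def loc_abs_continuous_on_def P_def by blast
  have Pc: "continuous_on {a..b} P" using ac[of a b] by (intro abs_continuous_on_imp_continuous_on) auto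
  have "continuous_on {a..b} (\<lambda>y. P y / D (\<phi> y))"
    using U(3) ab(3) Dpos by (intro continuous_on_divide Pc comp D) force
  moreover have "P y / D (\<phi> y) = deriv \<phi> y" if "y \<in> {a..b}" for y
    using Dpos[of "\<phi> y"] U(3)[of y] ab(3) that by (auto simp: P_def)
  ultimately have dc: "continuous_on {a..b} (deriv \<phi>)" by (rule continuous_on_eq)
  \<comment> \<open>Chosen so that P + R is G plus the integral of g(\<phi>), while R' collects all
    terms of the equation other than P'.\<close>
  define R where "R y = c * \<phi> y - f (\<phi> y) + integral {a..y} (\<lambda>z. g (\<phi> z))" for y
  have int: "((\<lambda>y. integral {a..y} (\<lambda>z. g (\<phi> z))) has_real_derivative g (\<phi> y)) (at y within {a..b})"
    if "y \<in> {a..b}" for y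
    by (rule integral_has_real_derivative[OF comp[OF g] that])
  have "(f has_real_derivative h (\<phi> y)) (at (\<phi> y))" if "y \<in> {a..b}" for y
    using f[of "\<phi> y"] U(3)[of y] ab(3) that by (auto simp: at_within_Icc_at)
  then have f\<phi>: "((\<lambda>y. f (\<phi> y)) has_real_derivative h (\<phi> y) * deriv \<phi> y) (at y within {a..b})"
    if "y \<in> {a..b}" for y
    using DERIV_chain2 \<phi> has_field_derivative_at_within that by blast
  have R: "(R has_real_derivative (c - h (\<phi> y)) * deriv \<phi> y + g (\<phi> y)) (at y within {a..b})"
    if "y \<in> {a..b}" for y
  proof -
    have "(R has_real_derivative c * deriv \<phi> y - h (\<phi> y) * deriv \<phi> y + g (\<phi> y)) (at y within {a..b})"
      unfolding R_def using that
      by (intro DERIV_add DERIV_diff DERIV_cmult f\<phi> int has_field_derivative_at_within[OF \<phi>])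
    then show ?thesis by (simp add: left_diff_distrib)
  qed
  have "continuous_on {a..b} (\<lambda>y. (c - h (\<phi> y)) * deriv \<phi> y + g (\<phi> y))"
    by (intro continuous_intros comp h g dc)
  from continuous_derivative_lipschitz[OF R this]
  obtain K where K: "K-lipschitz_on {a..b} R" by metis
  have "AE y in lebesgue. y \<in> S \<longrightarrow> P differentiable (at y) \<and>
      deriv P y + (c - h (\<phi> y)) * deriv \<phi> y + g (\<phi> y) = 0"
    using cl unfolding classical_on_def P_def by auto
  then have ae: "AE y in lebesgue. y \<in> {a<..<b} \<longrightarrow> ((\<lambda>y. P y + R y) has_real_derivative 0) (at y)"
  proof (rule eventually_mono, intro impI)
    fix y assume *: "y \<in> S \<longrightarrow> P differentiable (at y) \<and>
      deriv P y + (c - h (\<phi> y)) * deriv \<phi> y + g (\<phi> y) = 0" and y: "y \<in> {a<..<b}"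
    have "y \<in> S" using y ab(3) U(2) by (meson greaterThanLessThan_subseteq_atLeastAtMost_iff order_refl subsetD)
    then have "(P has_real_derivative deriv P y) (at y)"
      using * by (simp add: DERIV_deriv_iff_real_differentiable)
    moreover have "(R has_real_derivative (c - h (\<phi> y)) * deriv \<phi> y + g (\<phi> y)) (at y)"
      using R[of y] y by (auto simp: at_within_Icc_at)
    ultimately have "((\<lambda>y. P y + R y) has_real_derivative
        deriv P y + ((c - h (\<phi> y)) * deriv \<phi> y + g (\<phi> y))) (at y)"
      by (rule DERIV_add)
    then show "((\<lambda>y. P y + R y) has_real_derivative 0) (at y)"
      using * \<open>y \<in> S\<close> by (simp add: add.assoc)
  qed
  \<comment> \<open>Strictly inside (a, b), because the vanishing two-sided derivative is available
    only there.\<close>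
  have const: "P t + R t = P s + R s" if "a < s" "s \<le> t" "t < b" for s t
  proof -
    have "{s..t} \<subseteq> {a..b}" using that by auto
    then have "abs_continuous_on {s..t} (\<lambda>y. P y + R y)"
      by (intro abs_continuous_on_add ac lipschitz_on_imp_abs_continuous_on[of K] lipschitz_on_subset[OF K])
    moreover have "AE y in lebesgue. y \<in> {s..t} \<longrightarrow> ((\<lambda>y. P y + R y) has_real_derivative 0) (at y)"
      using ae by (rule eventually_mono) (use that in auto)
    ultimately show ?thesis
      using abs_continuous_on_zero_derivative[of s t "\<lambda>y. P y + R y"] that(2) by simp
  qed
  have "((\<lambda>y. P x + R x - integral {a..y} (\<lambda>z. g (\<phi> z))) has_real_derivative - g (\<phi> x)) (at x)"
    using DERIV_diff[OF DERIV_const[of "P x + R x"] int[of x]] ab by (simp add: at_within_Icc_at)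
  then show ?thesis
  proof (rule has_field_derivative_transform_within_open[of _ _ _ "{a<..<b}"])
    fix y assume y: "y \<in> {a<..<b}"
    have "P y + R y = P x + R x"
      using const[of x y] const[of y x] ab y by (cases "x \<le> y") auto
    then show "P x + R x - integral {a..y} (\<lambda>z. g (\<phi> z)) = G y"
      by (simp add: G_def P_def R_def)
  qed (use ab in auto)
qed

subsection \<open>Decreasing profiles\<close>

text \<open>Common ground of the two directions. The weak formulation enters only through the last
  assumption. The velocity \<open>v\<close> is a parameter because a reflected profile has velocity
  \<open>- deriv \<phi> (- \<xi>)\<close>; it is tied to \<phi> only where \<phi> < rbar.\<close>

locale decreasing_profile =
  fixes rbar c w :: real and f D g \<phi> v :: "real \<Rightarrow> real"
  assumes rbar: "rbar > 0"
    and f_cont: "continuous_on {0..rbar} f"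
    and g_cont: "continuous_on {0..rbar} g"
    and D_pos: "\<And>r. r \<in> {0<..<rbar} \<Longrightarrow> D r > 0"
    and g_pos: "\<And>r. r \<in> {0..<rbar} \<Longrightarrow> g r > 0"
    and \<phi>_range: "\<And>\<xi>. \<xi> < w \<Longrightarrow> 0 < \<phi> \<xi> \<and> \<phi> \<xi> \<le> rbar"
    and \<phi>_antimono: "\<And>\<xi> \<eta>. \<xi> \<le> \<eta> \<Longrightarrow> \<eta> < w \<Longrightarrow> \<phi> \<eta> \<le> \<phi> \<xi>"
    and \<phi>_cont: "continuous_on {..<w} \<phi>"
    and \<phi>_lim: "(\<phi> \<longlongrightarrow> rbar) at_bot"
    and \<phi>_less: "\<exists>\<xi><w. \<phi> \<xi> < rbar"
    and \<phi>_deriv: "\<And>\<xi>. \<xi> < w \<Longrightarrow> \<phi> \<xi> < rbar \<Longrightarrow> (\<phi> has_real_derivative v \<xi>) (at \<xi>)"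
    and flux_deriv_expanded: "\<And>\<xi>. \<xi> < w \<Longrightarrow> \<phi> \<xi> < rbar \<Longrightarrow>
      ((\<lambda>\<xi>. D (\<phi> \<xi>) * v \<xi> - f (\<phi> \<xi>) + c * \<phi> \<xi>) has_real_derivative - g (\<phi> \<xi>)) (at \<xi>)"
    and flux_no_jump_expanded: "\<And>a l. a < w \<Longrightarrow> (\<And>\<xi>. \<xi> \<le> a \<Longrightarrow> \<phi> \<xi> = rbar) \<Longrightarrow>
      (\<And>\<xi>. a < \<xi> \<Longrightarrow> \<xi> < w \<Longrightarrow> \<phi> \<xi> < rbar) \<Longrightarrow>
      ((\<lambda>\<xi>. D (\<phi> \<xi>) * v \<xi> - f (\<phi> \<xi>) + c * \<phi> \<xi>) \<longlongrightarrow> l) (at_right a) \<Longrightarrow> l = c * rbar - f rbar"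
begin

definition flux :: "real \<Rightarrow> real" where
  "flux \<xi> = D (\<phi> \<xi>) * v \<xi> - f (\<phi> \<xi>) + c * \<phi> \<xi>"

definition q :: "real \<Rightarrow> real" where
  "q r = c * r - f r"

lemmas flux_deriv = flux_deriv_expanded[folded flux_def]
lemmas flux_no_jump = flux_no_jump_expanded[folded flux_def q_def]

lemma \<phi>_Icc: "\<xi> < w \<Longrightarrow> \<phi> \<xi> \<in> {0..rbar}"
  using \<phi>_range[of \<xi>] by auto

section \<open>Monotonicity of the flux and of the profile\<close>

lemma velocity_nonpos:
  assumes "\<xi> < w" "\<phi> \<xi> < rbar"
  shows "v \<xi> \<le> 0"
proof (rule ccontr)
  assume "\<not> v \<xi> \<le> 0"
  then obtain d where d: "d > 0" "\<And>h. 0 < h \<Longrightarrow> h < d \<Longrightarrow> \<phi> \<xi> < \<phi> (\<xi> + h)"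
    using DERIV_pos_inc_right[OF \<phi>_deriv[OF assms]] by (meson not_le)
  obtain h where h: "h > 0" "h < d" "h < w - \<xi>"
    using field_lbound_gt_zero[OF d(1), of "w - \<xi>"] assms(1) by auto
  show False using d(2)[OF h(1,2)] \<phi>_antimono[of \<xi> "\<xi> + h"] h by simp
qed

lemma flux_le:
  assumes "\<xi> < w" "\<phi> \<xi> < rbar"
  shows "flux \<xi> \<le> q (\<phi> \<xi>)"
  using mult_nonneg_nonpos[OF less_imp_le[OF D_pos] velocity_nonpos[OF assms], of "\<phi> \<xi>"] assms \<phi>_range[of \<xi>]
  by (simp add: flux_def q_def)

text \<open>Mean value theorem: \<phi> is nonincreasing, so \<phi> < rbar persists to the right of
  \<xi> and the flux equation holds on the whole interval.\<close>

lemma flux_decrement: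
  assumes "\<xi> < \<eta>" "\<eta> < w" "\<phi> \<xi> < rbar"
  obtains \<zeta> where "\<xi> < \<zeta>" "\<zeta> < \<eta>" "flux \<xi> - flux \<eta> = (\<eta> - \<xi>) * g (\<phi> \<zeta>)"
proof -
  have "(flux has_real_derivative - g (\<phi> x)) (at x)" if "\<xi> \<le> x" "x \<le> \<eta>" for x
    using that assms \<phi>_antimono[of \<xi> x] by (intro flux_deriv) auto
  with MVT2[OF assms(1), of flux "\<lambda>x. - g (\<phi> x)"]
  obtain z where "\<xi> < z" "z < \<eta>" "flux \<eta> - flux \<xi> = (\<eta> - \<xi>) * - g (\<phi> z)" by auto
  then show thesis by (intro that[of z]) auto
qed

text \<open>On an interval where \<phi> = k the velocity is 0 and the flux is stuck at q(k), yet
  g(k) > 0 forces it to drop.\<close>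

lemma strictly_decreasing:
  assumes "\<xi> < \<eta>" "\<eta> < w" "\<phi> \<xi> < rbar"
  shows "\<phi> \<eta> < \<phi> \<xi>"
proof (rule ccontr)
  assume "\<not> \<phi> \<eta> < \<phi> \<xi>"
  define k where "k = \<phi> \<xi>"
  have const: "\<phi> x = k" if "\<xi> \<le> x" "x \<le> \<eta>" for x
    using that assms(2) \<open>\<not> \<phi> \<eta> < \<phi> \<xi>\<close> \<phi>_antimono[of \<xi> x] \<phi>_antimono[of x \<eta>] by (auto simp: k_def)
  have k: "k \<in> {0<..<rbar}" using assms \<phi>_range[of \<xi>] by (auto simp: k_def)
  have "v x = 0" if x: "x \<in> {\<xi><..<\<eta>}" for x
  proof -
    have "((\<lambda>x. k) has_real_derivative 0) (at x)" by simp
    then have "(\<phi> has_real_derivative 0) (at x)"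
      by (rule has_field_derivative_transform_within_open[of _ _ _ "{\<xi><..<\<eta>}"]) (use x const in auto)
    moreover have "(\<phi> has_real_derivative v x) (at x)"
      using x assms(2) k const[of x] by (intro \<phi>_deriv) auto
    ultimately show ?thesis by (rule DERIV_unique[symmetric])
  qed
  then have fl: "flux x = q k" if "x \<in> {\<xi><..<\<eta>}" for x
    using that const[of x] by (auto simp: flux_def q_def)
  \<comment> \<open>Interior points, since \<open>fl\<close> is known only in the open
    interval.\<close>
  define s t where "s = (2 * \<xi> + \<eta>) / 3" and "t = (\<xi> + 2 * \<eta>) / 3"
  have st: "\<xi> < s" "s < t" "t < \<eta>" using assms by (auto simp: s_def t_def)
  obtain z where z: "s < z" "z < t" "flux s - flux t = (t - s) * g (\<phi> z)"
    using flux_decrement[of s t] st assms(2) k const[of s] by auto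
  moreover have "g (\<phi> z) > 0" using g_pos[of k] k const[of z] z st by auto
  ultimately show False using st fl[of s] fl[of t] by auto
qed

section \<open>Profiles with a plateau\<close>

lemma plateau_boundary:
  assumes "\<xi>\<^sub>0 < w" "\<phi> \<xi>\<^sub>0 = rbar"
  shows "\<exists>a<w. (\<forall>\<xi>\<le>a. \<phi> \<xi> = rbar) \<and> (\<forall>\<xi>. a < \<xi> \<longrightarrow> \<xi> < w \<longrightarrow> \<phi> \<xi> < rbar)"
proof -
  obtain \<xi>\<^sub>1 where \<xi>1: "\<xi>\<^sub>1 < w" "\<phi> \<xi>\<^sub>1 < rbar" using \<phi>_less by blast
  have le: "\<xi>\<^sub>0 \<le> \<xi>\<^sub>1" using \<phi>_antimono[of \<xi>\<^sub>1 \<xi>\<^sub>0] assms \<xi>1 by force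
  define S where "S = {\<xi> \<in> {\<xi>\<^sub>0..\<xi>\<^sub>1}. \<phi> \<xi> = rbar}"
  have "continuous_on {\<xi>\<^sub>0..\<xi>\<^sub>1} \<phi>" by (rule continuous_on_subset[OF \<phi>_cont]) (use \<xi>1 in auto)
  then have "closed S" unfolding S_def by (intro continuous_closed_preimage_constant) auto
  moreover have "bounded S" by (rule bounded_subset[of "{\<xi>\<^sub>0..\<xi>\<^sub>1}"]) (auto simp: S_def)
  moreover have "\<xi>\<^sub>0 \<in> S" using assms le by (auto simp: S_def)
  ultimately obtain a where a: "a \<in> S" "\<And>\<xi>. \<xi> \<in> S \<Longrightarrow> \<xi> \<le> a"
    using compact_attains_sup[of S] by (auto simp: compact_eq_bounded_closed)
  show ?thesis
  proof (intro exI[of _ a] conjI allI impI)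
    show "a < w" using a(1) \<xi>1 by (auto simp: S_def)
    show "\<phi> \<xi> = rbar" if "\<xi> \<le> a" for \<xi>
      using \<phi>_antimono[of \<xi> a] \<phi>_range[of \<xi>] that a(1) \<xi>1 by (auto simp: S_def)
    show "\<phi> \<xi> < rbar" if "a < \<xi>" "\<xi> < w" for \<xi>
    proof (cases "\<xi> \<le> \<xi>\<^sub>1")
      case True
      then have "\<phi> \<xi> \<noteq> rbar" using a(1) a(2)[of \<xi>] that by (auto simp: S_def)
      then show ?thesis using that \<phi>_range[of \<xi>] by auto
    next
      case False
      then show ?thesis using \<phi>_antimono[of \<xi>\<^sub>1 \<xi>] \<xi>1 that by auto
    qed
  qed
qed

text \<open>The no-jump property identifies a right limit but does not provide one. Its existence
  follows because the flux plus the integral of g(\<phi>) from a is constant to the right of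
  a.\<close>

lemma flux_limit_at_plateau:
  assumes "a < w" and plateau: "\<And>\<xi>. \<xi> \<le> a \<Longrightarrow> \<phi> \<xi> = rbar"
    and less: "\<And>\<xi>. a < \<xi> \<Longrightarrow> \<xi> < w \<Longrightarrow> \<phi> \<xi> < rbar"
  shows "(flux \<longlongrightarrow> q rbar) (at_right a)"
proof -
  define b where "b = (a + w) / 2"
  have b: "a < b" "b < w" using assms(1) by (auto simp: b_def)
  define H where "H x = integral {a..x} (\<lambda>z. g (\<phi> z))" for x
  have "continuous_on {a..b} (\<lambda>z. g (\<phi> z))"
    by (rule continuous_on_compose2[OF g_cont continuous_on_subset[OF \<phi>_cont]])
      (use b \<phi>_Icc in \<open>auto simp del: atLeastAtMost_iff simp: subset_iff\<close>, use b in auto)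
  then have H: "(H has_real_derivative g (\<phi> x)) (at x within {a..b})" if "x \<in> {a..b}" for x
    unfolding H_def using that by (rule integral_has_real_derivative)
  have "\<exists>C. \<forall>x\<in>{a<..<b}. flux x + H x = C"
  proof (rule has_field_derivative_zero_constant)
    fix x assume x: "x \<in> {a<..<b}"
    then have "(H has_real_derivative g (\<phi> x)) (at x)" using H[of x] by (auto simp: at_within_Icc_at)
    moreover have "(flux has_real_derivative - g (\<phi> x)) (at x)"
      using x b by (intro flux_deriv less) auto
    ultimately have "((\<lambda>x. flux x + H x) has_real_derivative 0) (at x)"
      using DERIV_add[of flux "- g (\<phi> x)" x UNIV H "g (\<phi> x)"] by simp
    then show "((\<lambda>x. flux x + H x) has_real_derivative 0) (at x within {a<..<b})"
      by (rule DERIV_subset) simp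
  qed auto
  then obtain C where C: "\<And>x. x \<in> {a<..<b} \<Longrightarrow> flux x + H x = C" by blast
  have "(H \<longlongrightarrow> H a) (at a within {a..b})"
    using DERIV_continuous[OF H[of a]] b by (simp add: continuous_within)
  then have "(H \<longlongrightarrow> 0) (at_right a)"
    using b by (simp add: H_def at_within_Icc_at_right)
  then have "((\<lambda>x. C - H x) \<longlongrightarrow> C - 0) (at_right a)" by (intro tendsto_intros)
  moreover have "\<forall>\<^sub>F x in at_right a. C - H x = flux x"
    using eventually_at_right_real[OF b(1)] by (rule eventually_mono) (use C in force)
  ultimately have lim: "(flux \<longlongrightarrow> C) (at_right a)" by (simp add: Lim_transform_eventually)
  then have "C = q rbar"
    using flux_no_jump[of a C] assms by blast
  with lim show ?thesis by simp
qed

lemma no_plateau: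
  assumes "L > 0" and gL: "\<forall>\<^sub>F r in at_left rbar. g r \<le> L * (rbar - r)"
    and "\<eta> > 0" and q\<eta>: "\<forall>\<^sub>F r in at_left rbar. \<eta> * (rbar - r) \<le> q rbar - q r"
    and "\<xi> < w"
  shows "\<phi> \<xi> < rbar"
proof (rule ccontr)
  assume "\<not> \<phi> \<xi> < rbar"
  with \<open>\<xi> < w\<close> \<phi>_range[of \<xi>] have eq: "\<phi> \<xi> = rbar" by auto
  obtain a where a: "a < w" "\<And>\<xi>. \<xi> \<le> a \<Longrightarrow> \<phi> \<xi> = rbar" "\<And>\<xi>. a < \<xi> \<Longrightarrow> \<xi> < w \<Longrightarrow> \<phi> \<xi> < rbar"
    using plateau_boundary[OF \<open>\<xi> < w\<close> eq] by blast
  obtain r0 where r0: "r0 < rbar" "\<And>r. r0 < r \<Longrightarrow> r < rbar \<Longrightarrow> g r \<le> L * (rbar - r)"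
    "\<And>r. r0 < r \<Longrightarrow> r < rbar \<Longrightarrow> \<eta> * (rbar - r) \<le> q rbar - q r"
    using eventually_conj[OF gL q\<eta>] unfolding eventually_at_left_field by blast
  have "isCont \<phi> a" using \<phi>_cont a(1) by (simp add: continuous_on_eq_continuous_at)
  then have "(\<phi> \<longlongrightarrow> rbar) (at_right a)"
    using a(2)[of a] by (auto simp: isCont_def intro: filterlim_at_within_not_equal tendsto_within_subset)
  then have "\<forall>\<^sub>F x in at_right a. r0 < \<phi> x" using r0(1) by (rule order_tendstoD)
  \<comment> \<open>Staying below a + \<eta>/L gives (x - a) L < \<eta>, which makes the upper and
    lower bounds for q(rbar) - flux(x) incompatible.\<close>
  moreover have "\<forall>\<^sub>F x in at_right a. x < w" "\<forall>\<^sub>F x in at_right a. x < a + \<eta> / L" "\<forall>\<^sub>F x in at_right a. a < x"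
    using a(1) \<open>\<eta> > 0\<close> \<open>L > 0\<close> by (auto intro: eventually_at_right_less order_tendstoD(2)[OF tendsto_ident_at])
  ultimately have "\<forall>\<^sub>F x in at_right a. r0 < \<phi> x \<and> x < w \<and> x < a + \<eta> / L \<and> a < x"
    by eventually_elim auto
  then obtain x where x: "r0 < \<phi> x" "x < w" "x < a + \<eta> / L" "a < x"
    using eventually_happens trivial_limit_at_right_real by (metis (no_types, lifting))
  have less: "\<phi> x < rbar" using a(3) x by blast
  \<comment> \<open>The flux at a itself is not controlled; the estimate starts from s > a and
    passes to the limit.\<close>
  have "q rbar - flux x \<le> (x - a) * (L * (rbar - \<phi> x))"
  proof (rule tendsto_upperbound)
    show "((\<lambda>s. flux s - flux x) \<longlongrightarrow> q rbar - flux x) (at_right a)"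
      by (intro tendsto_intros flux_limit_at_plateau a)
    have "flux s - flux x \<le> (x - a) * (L * (rbar - \<phi> x))" if s: "a < s" "s < x" for s
    proof -
      obtain z where z: "s < z" "z < x" "flux s - flux x = (x - s) * g (\<phi> z)"
        using flux_decrement[of s x] s x a(3)[of s] by auto
      have "\<phi> x \<le> \<phi> z" using \<phi>_antimono z x by auto
      then have "g (\<phi> z) \<le> L * (rbar - \<phi> z)" using r0(2)[of "\<phi> z"] a(3)[of z] z s x by auto
      also have "\<dots> \<le> L * (rbar - \<phi> x)" using \<open>\<phi> x \<le> \<phi> z\<close> \<open>L > 0\<close> by simp
      finally have "(x - s) * g (\<phi> z) \<le> (x - s) * (L * (rbar - \<phi> x))"
        using s by (intro mult_left_mono) auto
      also have "\<dots> \<le> (x - a) * (L * (rbar - \<phi> x))"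
        using s less \<open>L > 0\<close> by (intro mult_right_mono) auto
      finally show ?thesis by (simp add: z(3))
    qed
    then show "\<forall>\<^sub>F s in at_right a. flux s - flux x \<le> (x - a) * (L * (rbar - \<phi> x))"
      using eventually_at_right_real[OF x(4)] by (auto elim!: eventually_mono)
  qed simp
  moreover have "\<eta> * (rbar - \<phi> x) \<le> q rbar - q (\<phi> x)" using r0(3) x less by blast
  moreover have "flux x \<le> q (\<phi> x)" using flux_le x less by blast
  moreover have "(x - a) * L < \<eta>" using x(3) \<open>L > 0\<close> by (simp add: field_simps)
  then have "(x - a) * L * (rbar - \<phi> x) < \<eta> * (rbar - \<phi> x)" using less by (intro mult_strict_right_mono) auto
  ultimately show False by (simp add: mult.assoc)
qed

section \<open>Profiles without a plateau\<close>

text \<open>The flux decreases and lies below q(\<phi>), so its value at \<xi> is at most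
  q(\<phi>(x)) for every x < \<xi>; letting x tend to -\<infinity> replaces the limit at a plateau
  edge.\<close>

lemma flux_le_limit:
  assumes less: "\<And>\<xi>. \<xi> < w \<Longrightarrow> \<phi> \<xi> < rbar" and "\<xi> < w"
  shows "flux \<xi> \<le> q rbar"
proof (rule tendsto_lowerbound)
  have "continuous_on {0..rbar} q" unfolding q_def by (intro continuous_intros f_cont)
  moreover have "\<forall>\<^sub>F x in at_bot. \<phi> x \<in> {0..rbar}"
    using eventually_le_at_bot[of \<xi>] by (rule eventually_mono) (use assms(2) \<phi>_Icc in auto)
  ultimately show "((\<lambda>x. q (\<phi> x)) \<longlongrightarrow> q rbar) at_bot"
    using rbar by (intro continuous_on_tendsto_compose[OF _ \<phi>_lim]) auto
  show "\<forall>\<^sub>F x in at_bot. flux \<xi> \<le> q (\<phi> x)"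
    using eventually_gt_at_bot[of \<xi>]
  proof (rule eventually_mono)
    fix x assume "x < \<xi>"
    then obtain z where z: "x < z" "z < \<xi>" "flux x - flux \<xi> = (\<xi> - x) * g (\<phi> z)"
      using flux_decrement[of x \<xi>] assms(2) less[of x] by auto
    have "g (\<phi> z) > 0" using g_pos[of "\<phi> z"] less[of z] \<phi>_range[of z] z assms(2) by auto
    then have "flux x - flux \<xi> \<ge> 0" unfolding z(3) using z(1,2) by simp
    then have "flux \<xi> \<le> flux x" by simp
    also have "\<dots> \<le> q (\<phi> x)" using flux_le less \<open>x < \<xi>\<close> assms(2) by auto
    finally show "flux \<xi> \<le> q (\<phi> x)" .
  qed
qed simp

text \<open>Otherwise the gap rbar - \<phi> lies between u/2 and u on the whole window of length
  \<tau>. The flux lost over the first half forces a speed of at least C L / (8 M) throughout the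
  second half, so the profile falls there by at least u. The number u only bounds the gap, which
  allows iteration with successive halves.\<close>

lemma halving_step:
  assumes less: "\<And>\<xi>. \<xi> < w \<Longrightarrow> \<phi> \<xi> < rbar"
    and \<alpha>: "0 < \<alpha>" "\<alpha> < 1" and pos: "L > 0" "K > 0" "M > 0"
    and qK: "\<And>r. r \<in> {0..rbar} \<Longrightarrow> q rbar - q r \<le> K * (rbar - r)"
    and DM: "\<And>r. r \<in> {0..rbar} \<Longrightarrow> D r \<le> M * (rbar - r)"
    and C: "C = 8 * K / L + 16 * M / L + 1"
    and "\<xi> < w" and near: "\<And>\<zeta>. \<zeta> \<le> \<xi> \<Longrightarrow> L * (rbar - \<phi> \<zeta>) powr \<alpha> \<le> g (\<phi> \<zeta>)"
    and u: "0 < u" "u \<le> 1" "rbar - \<phi> \<xi> \<le> u"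
  shows "rbar - \<phi> (\<xi> - C * u powr (1 - \<alpha>)) \<le> u / 2"
proof (rule ccontr)
  define \<tau> where "\<tau> = C * u powr (1 - \<alpha>)"
  assume "\<not> rbar - \<phi> (\<xi> - C * u powr (1 - \<alpha>)) \<le> u / 2"
  then have lower: "u / 2 < rbar - \<phi> (\<xi> - \<tau>)" by (simp add: \<tau>_def)
  \<comment> \<open>The three summands of C: 8 K / L absorbs the Lipschitz term K u, 16 M / L makes
    C L / (16 M) at least 1, and 1 gives this bound.\<close>
  have "C \<ge> 1" using C pos by simp
  have "\<tau> > 0" using \<open>C \<ge> 1\<close> u by (simp add: \<tau>_def)
  have between: "u / 2 < rbar - \<phi> x" "rbar - \<phi> x \<le> u" if "\<xi> - \<tau> \<le> x" "x \<le> \<xi>" for x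
    using \<phi>_antimono[of "\<xi> - \<tau>" x] \<phi>_antimono[of x \<xi>] that lower u(3) \<open>\<xi> < w\<close> by auto
  \<comment> \<open>Turns the lower bound u/2 of the gap into a multiple of u^\<alpha>; halving the
    base costs at most a factor 1/2 as \<alpha> < 1.\<close>
  have "(1 / 2 :: real) powr 1 \<le> (1 / 2) powr \<alpha>" using \<alpha> by (intro powr_mono') auto
  then have half: "u powr \<alpha> / 2 \<le> (u / 2) powr \<alpha>"
    using u(1) mult_left_mono[of "1 / 2" "(1 / 2) powr \<alpha>" "u powr \<alpha>"] powr_mult[of u "1 / 2" \<alpha>] by simp
  \<comment> \<open>The reason for the exponent 1 - \<alpha> in the step length: step times reaction
    is linear in u.\<close>
  have u_prod: "u powr (1 - \<alpha>) * u powr \<alpha> = u"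
    using u(1) by (simp add: powr_add[symmetric])
  have gz: "L * (u powr \<alpha> / 2) \<le> g (\<phi> z)" if "\<xi> - \<tau> \<le> z" "z \<le> \<xi>" for z
  proof -
    have "(u / 2) powr \<alpha> \<le> (rbar - \<phi> z) powr \<alpha>"
      using between[OF that] u \<alpha> by (intro powr_mono2) auto
    then have "L * (u powr \<alpha> / 2) \<le> L * (rbar - \<phi> z) powr \<alpha>"
      using half pos(1) by (intro mult_left_mono) auto
    also have "\<dots> \<le> g (\<phi> z)" using near that(2) by blast
    finally show ?thesis .
  qed
  have speed: "C * L / (8 * M) \<le> - v x" if x: "\<xi> - \<tau> / 2 \<le> x" "x \<le> \<xi>" for x
  proof -
    have "\<xi> - \<tau> < x" "x < w" using x \<open>\<tau> > 0\<close> \<open>\<xi> < w\<close> by auto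
    then obtain z where z: "\<xi> - \<tau> < z" "z < x"
      "flux (\<xi> - \<tau>) - flux x = (x - (\<xi> - \<tau>)) * g (\<phi> z)"
      using flux_decrement[of "\<xi> - \<tau>" x] less[of "\<xi> - \<tau>"] by auto
    \<comment> \<open>At least half of the window precedes x, and the reaction is at least L
      u^\<alpha> / 2 there.\<close>
    have "C * L / 4 * u = \<tau> / 2 * (L * (u powr \<alpha> / 2))"
      using u_prod by (simp add: \<tau>_def)
    also have "\<dots> \<le> (x - (\<xi> - \<tau>)) * g (\<phi> z)"
      using x z gz[of z] pos u \<open>\<tau> > 0\<close> by (intro mult_mono) auto
    also have "\<dots> \<le> q rbar - flux x"
      using z(3) flux_le_limit[OF less, of "\<xi> - \<tau>"] \<open>\<xi> < w\<close> \<open>\<tau> > 0\<close> by simp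
    also have "\<dots> = (q rbar - q (\<phi> x)) + D (\<phi> x) * (- v x)" by (simp add: flux_def q_def)
    also have "\<dots> \<le> K * u + (M * u) * (- v x)"
    proof (intro add_mono mult_right_mono)
      have xI: "\<phi> x \<in> {0..rbar}" "rbar - \<phi> x \<le> u"
        using \<phi>_Icc[OF \<open>x < w\<close>] between(2)[of x] \<open>\<xi> - \<tau> < x\<close> x by auto
      show "q rbar - q (\<phi> x) \<le> K * u"
        using pos by (intro order_trans[OF qK[OF xI(1)]] mult_left_mono xI(2)) auto
      show "D (\<phi> x) \<le> M * u"
        using pos by (intro order_trans[OF DM[OF xI(1)]] mult_left_mono xI(2)) auto
      show "0 \<le> - v x" using velocity_nonpos[of x] less \<open>x < w\<close> by simp
    qed
    finally have "u * (C * L / 4 - K) \<le> u * (M * (- v x))" by (simp add: algebra_simps)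
    then have "C * L / 4 - K \<le> M * (- v x)" using u(1) by (rule mult_left_le_imp_le)
    moreover have "C * L / 8 \<ge> K" using pos by (simp add: C field_simps)
    ultimately have "C * L / 8 \<le> M * (- v x)" by linarith
    then show ?thesis using pos by (simp add: field_simps)
  qed
  have "\<exists>z. \<xi> - \<tau> / 2 < z \<and> z < \<xi> \<and> \<phi> \<xi> - \<phi> (\<xi> - \<tau> / 2) = (\<xi> - (\<xi> - \<tau> / 2)) * v z"
    using \<open>\<tau> > 0\<close> \<open>\<xi> < w\<close> by (intro MVT2 \<phi>_deriv less) auto
  then obtain z where z: "\<xi> - \<tau> / 2 < z" "z < \<xi>" "\<phi> (\<xi> - \<tau> / 2) - \<phi> \<xi> = \<tau> / 2 * (- v z)"
    by (auto simp: algebra_simps)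
  have "16 * M \<le> C * L" using pos by (simp add: C field_simps)
  then have "1 \<le> C * L / (16 * M)" using pos by (simp add: field_simps)
  \<comment> \<open>C enters twice: through the length \<tau> and through the lower bound of the
    speed.\<close>
  then have "1 * 1 \<le> C * (C * L / (16 * M))" using \<open>C \<ge> 1\<close> by (intro mult_mono) auto
  moreover have "u \<le> u powr (1 - \<alpha>)" using powr_mono'[of "1 - \<alpha>" 1 u] u \<alpha> by simp
  ultimately have "1 * u \<le> C * (C * L / (16 * M)) * u powr (1 - \<alpha>)"
    using u by (intro mult_mono) auto
  also have "\<dots> = \<tau> / 2 * (C * L / (8 * M))" using pos by (simp add: \<tau>_def field_simps)
  also have "\<dots> \<le> \<tau> / 2 * (- v z)" using speed[of z] z \<open>\<tau> > 0\<close> by (intro mult_left_mono) auto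
  finally have "u \<le> \<phi> (\<xi> - \<tau> / 2) - \<phi> \<xi>" by (simp only: z(3) mult_1)
  moreover have "u / 2 < rbar - \<phi> (\<xi> - \<tau> / 2)" using \<open>\<tau> > 0\<close> by (intro between) auto
  ultimately show False using u by linarith
qed

lemma plateau_exists:
  assumes \<alpha>: "0 < \<alpha>" "\<alpha> < 1" and pos: "L > 0" "K > 0" "M > 0"
    and gL: "\<forall>\<^sub>F r in at_left rbar. L * (rbar - r) powr \<alpha> \<le> g r"
    and qK: "\<And>r. r \<in> {0..rbar} \<Longrightarrow> q rbar - q r \<le> K * (rbar - r)"
    and DM: "\<And>r. r \<in> {0..rbar} \<Longrightarrow> D r \<le> M * (rbar - r)"
  shows "\<exists>\<xi><w. \<forall>\<zeta>\<le>\<xi>. \<phi> \<zeta> = rbar"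
proof (rule ccontr)
  assume no: "\<not> (\<exists>\<xi><w. \<forall>\<zeta>\<le>\<xi>. \<phi> \<zeta> = rbar)"
  have less: "\<phi> \<xi> < rbar" if "\<xi> < w" for \<xi>
  proof (rule ccontr)
    assume "\<not> \<phi> \<xi> < rbar"
    then have "\<phi> \<zeta> = rbar" if "\<zeta> \<le> \<xi>" for \<zeta>
      using \<phi>_antimono[OF that] \<phi>_range[of \<zeta>] that \<open>\<xi> < w\<close> by auto
    then show False using no \<open>\<xi> < w\<close> by blast
  qed
  obtain r0 where r0: "r0 < rbar" "\<And>r. r0 < r \<Longrightarrow> r < rbar \<Longrightarrow> L * (rbar - r) powr \<alpha> \<le> g r"
    using gL unfolding eventually_at_left_field by blast
  \<comment> \<open>The condition rbar - 1 < \<phi> makes the initial gap at most 1, as the halving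
    step demands.\<close>
  have "\<forall>\<^sub>F \<xi> in at_bot. r0 < \<phi> \<xi> \<and> rbar - 1 < \<phi> \<xi> \<and> \<xi> < w"
    using r0(1) by (intro eventually_conj order_tendstoD(1)[OF \<phi>_lim] eventually_gt_at_bot) auto
  then obtain \<xi>\<^sub>0 where \<xi>0: "r0 < \<phi> \<xi>\<^sub>0" "rbar - 1 < \<phi> \<xi>\<^sub>0" "\<xi>\<^sub>0 < w"
    using eventually_happens[of _ at_bot] by (metis (no_types, lifting) trivial_limit_at_bot_linorder)
  have near: "L * (rbar - \<phi> \<zeta>) powr \<alpha> \<le> g (\<phi> \<zeta>)" if "\<zeta> \<le> \<xi>\<^sub>0" for \<zeta>
    using r0(2)[of "\<phi> \<zeta>"] \<phi>_antimono[OF that \<xi>0(3)] \<xi>0 less[of \<zeta>] that by auto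
  define C where "C = 8 * K / L + 16 * M / L + 1"
  have "C > 0" using pos by (simp add: C_def add_pos_pos)
  define u0 where "u0 = rbar - \<phi> \<xi>\<^sub>0"
  have u0: "0 < u0" "u0 \<le> 1" using less[OF \<xi>0(3)] \<xi>0(2) by (auto simp: u0_def)
  define s where "s = (1 / 2 :: real) powr (1 - \<alpha>)"
  have s: "0 < s" "s < 1" using \<alpha> powr_less_mono'[of "1 / 2 :: real" 0 "1 - \<alpha>"] by (auto simp: s_def)
  \<comment> \<open>The sum of the step lengths C (u0 / 2^n)^(1-\<alpha>), a geometric series with
    ratio s < 1; its partial sums are T (1 - s^n).\<close>
  define T where "T = C * u0 powr (1 - \<alpha>) / (1 - s)"
  have "T > 0" using \<open>C > 0\<close> u0 s by (simp add: T_def)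
  have decay: "rbar - \<phi> (\<xi>\<^sub>0 - T * (1 - s ^ n)) \<le> u0 * (1 / 2) ^ n" for n
  proof (induction n)
    case 0
    then show ?case by (simp add: u0_def)
  next
    case (Suc n)
    have sn: "0 < s ^ n" "s ^ n \<le> 1" using s by (auto intro: power_le_one)
    define \<xi> where "\<xi> = \<xi>\<^sub>0 - T * (1 - s ^ n)"
    have "\<xi> \<le> \<xi>\<^sub>0" using sn \<open>T > 0\<close> by (simp add: \<xi>_def)
    have "(u0 * (1 / 2) ^ n) powr (1 - \<alpha>) = u0 powr (1 - \<alpha>) * s ^ n"
      using u0 by (simp add: powr_mult s_def powr_realpow[symmetric] powr_powr mult.commute)
    then have "C * (u0 * (1 / 2) ^ n) powr (1 - \<alpha>) = T * (1 - s) * s ^ n"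
      using s by (simp add: T_def)
    then have "\<xi> - C * (u0 * (1 / 2) ^ n) powr (1 - \<alpha>) = \<xi>\<^sub>0 - T * (1 - s ^ Suc n)"
      by (simp add: \<xi>_def algebra_simps)
    moreover have "rbar - \<phi> (\<xi> - C * (u0 * (1 / 2) ^ n) powr (1 - \<alpha>)) \<le> u0 * (1 / 2) ^ n / 2"
    proof (rule halving_step[OF less \<alpha> pos qK DM C_def])
      show "u0 * (1 / 2) ^ n \<le> 1" using u0 by (intro mult_le_one power_le_one) auto
    qed (use \<open>\<xi> \<le> \<xi>\<^sub>0\<close> \<xi>0(3) near u0 Suc.IH in \<open>auto simp: \<xi>_def\<close>)
    ultimately show ?case by simp
  qed
  have "rbar - \<phi> (\<xi>\<^sub>0 - T) \<le> u0 * (1 / 2) ^ n" for n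
  proof -
    have "s ^ n \<ge> 0" "s ^ n \<le> 1" using s by (auto intro: power_le_one)
    then have "0 \<le> T * (1 - s ^ n)" "T * (1 - s ^ n) \<le> T"
      using \<open>T > 0\<close> mult_left_mono[of "1 - s ^ n" 1 T] by simp_all
    then have "\<phi> (\<xi>\<^sub>0 - T * (1 - s ^ n)) \<le> \<phi> (\<xi>\<^sub>0 - T)"
      using \<xi>0(3) by (intro \<phi>_antimono) auto
    with decay[of n] show ?thesis by simp
  qed
  then have "\<exists>N. \<forall>n\<ge>N. rbar - \<phi> (\<xi>\<^sub>0 - T) \<le> u0 * (1 / 2) ^ n" by blast
  moreover have "(\<lambda>n. u0 * (1 / 2) ^ n) \<longlonglongrightarrow> u0 * 0"
    by (rule tendsto_mult_left, rule LIMSEQ_realpow_zero) auto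
  ultimately have "rbar - \<phi> (\<xi>\<^sub>0 - T) \<le> u0 * 0"
    using LIMSEQ_le_const by blast
  then show False using less[of "\<xi>\<^sub>0 - T"] \<xi>0(3) \<open>T > 0\<close> by auto
qed

end

subsection \<open>Semi-wavefronts\<close>

lemma has_derivative_pos_eventually_at_left:
  fixes F :: "real \<Rightarrow> real"
  assumes "(F has_real_derivative l) (at b within {a..b})" and "a < b" "0 < l"
  shows "\<forall>\<^sub>F x in at_left b. l / 2 * (b - x) \<le> F b - F x"
proof -
  have "((\<lambda>x. (F x - F b) / (x - b)) \<longlongrightarrow> l) (at_left b)"
    using assms(1,2) by (simp add: has_field_derivative_iff at_within_Icc_at_left)
  then have "\<forall>\<^sub>F x in at_left b. l / 2 < (F x - F b) / (x - b)"
    by (rule order_tendstoD) (use assms(3) in simp)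
  moreover have "\<forall>\<^sub>F x in at_left b. x < b"
    by (simp add: eventually_at_filter)
  ultimately show ?thesis
    by eventually_elim (simp add: field_simps)
qed

text \<open>At a sharp point g vanishes, and the only zero of g in [0, rbar] is rbar; so the
  exceptional point never lies below rbar.\<close>

lemma wave_profile_classical_below:
  assumes "wave_profile rbar D f h g c I \<phi>" and "\<And>r. r \<in> {0..<rbar} \<Longrightarrow> g r > 0"
  obtains S where "classical_on D h g c S \<phi>" "{\<xi> \<in> I. \<phi> \<xi> < rbar} \<subseteq> S"
proof (cases "classical_on D h g c I \<phi>")
  case True
  then show thesis by (rule that) auto
next
  case False
  then obtain l \<xi>\<^sub>0 where *: "g l = 0" "\<xi>\<^sub>0 \<in> I" "\<phi> \<xi>\<^sub>0 = l" "classical_on D h g c (I - {\<xi>\<^sub>0}) \<phi>"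
    using assms(1) by (auto simp: wave_profile_def sharp_at_def)
  have "\<phi> \<xi>\<^sub>0 \<in> {0..rbar}"
    using assms(1) *(2) by (auto simp: wave_profile_def traveling_wave_def)
  with assms(2)[of l] * have "l = rbar" by force
  with *(3) show thesis by (intro that[OF *(4)]) auto
qed

text \<open>Serves to keep profiles positive: the flux equation is derived where D(\<phi>) > 0, and
  D may vanish at 0.\<close>

lemma wave_profile_not_locally_zero:
  assumes wp: "wave_profile rbar D f h g c I \<phi>" and g: "\<And>r. r \<in> {0..<rbar} \<Longrightarrow> g r > 0"
    and "rbar > 0" "{s<..<t} \<subseteq> I" "s < t"
  shows "\<exists>x\<in>{s<..<t}. \<phi> x \<noteq> 0"
proof (rule ccontr)
  assume "\<not> (\<exists>x\<in>{s<..<t}. \<phi> x \<noteq> 0)"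
  then have zero: "\<phi> x = 0" if "x \<in> {s<..<t}" for x using that by blast
  obtain S where "classical_on D h g c S \<phi>" "{\<xi> \<in> I. \<phi> \<xi> < rbar} \<subseteq> S"
    using wave_profile_classical_below[OF wp g] by blast
  moreover have "{s<..<t} \<subseteq> {\<xi> \<in> I. \<phi> \<xi> < rbar}" using zero assms(3,4) by auto
  ultimately have "g 0 = 0"
    using classical_on_not_locally_constant[of D h g c S \<phi> s t 0] zero \<open>s < t\<close> by blast
  then show False using g[of 0] \<open>rbar > 0\<close> by simp
qed

locale positive_profile =
  fixes rbar c :: real and f h D g \<phi> :: "real \<Rightarrow> real" and I :: "real set"
  assumes rbar: "rbar > 0"
    and f: "\<And>r. r \<in> {0..rbar} \<Longrightarrow> (f has_real_derivative h r) (at r within {0..rbar})"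
    and h: "continuous_on {0..rbar} h" and D: "continuous_on {0..rbar} D"
    and D_pos: "\<And>r. r \<in> {0<..<rbar} \<Longrightarrow> D r > 0"
    and g: "continuous_on {0..rbar} g"
    and g_pos: "\<And>r. r \<in> {0..<rbar} \<Longrightarrow> g r > 0" and g_rbar: "g rbar = 0"
    and profile: "wave_profile rbar D f h g c I \<phi>"
    and pos: "\<And>\<xi>. \<xi> \<in> I \<Longrightarrow> 0 < \<phi> \<xi>"
begin

definition G :: "real \<Rightarrow> real" where
  "G \<xi> = D (\<phi> \<xi>) * deriv \<phi> \<xi> - f (\<phi> \<xi>) + c * \<phi> \<xi>"

lemma open_I: "open I" and \<phi>_cont: "continuous_on I \<phi>" and \<phi>_range: "\<xi> \<in> I \<Longrightarrow> \<phi> \<xi> \<in> {0<..rbar}"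
  using profile pos by (auto simp: wave_profile_def traveling_wave_def)

lemma DERIV_below:
  assumes "\<xi> \<in> I" "\<phi> \<xi> < rbar"
  shows "(\<phi> has_real_derivative deriv \<phi> \<xi>) (at \<xi>)" and "(G has_real_derivative - g (\<phi> \<xi>)) (at \<xi>)"
proof -
  obtain S where S: "classical_on D h g c S \<phi>" "{\<xi> \<in> I. \<phi> \<xi> < rbar} \<subseteq> S"
    using wave_profile_classical_below[OF profile g_pos] by blast
  then show "(\<phi> has_real_derivative deriv \<phi> \<xi>) (at \<xi>)"
    using assms by (auto simp: classical_on_def DERIV_deriv_iff_real_differentiable)
  have U: "open (I \<inter> \<phi> -` {0<..<rbar})"
    by (intro continuous_open_preimage \<phi>_cont open_I) auto
  show "(G has_real_derivative - g (\<phi> \<xi>)) (at \<xi>)"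
    unfolding G_def[abs_def]
    by (rule classical_flux_derivative[OF f h D D_pos g S(1) U]) (use S(2) assms \<phi>_range in auto)
qed

text \<open>As g(rbar) = 0, a plateau satisfies the same flux equation as the rest of the profile,
  so both sides of its edge fit \<open>weak_solution_no_jump\<close>.\<close>

lemma plateau_flux:
  assumes "{s<..<t} \<subseteq> I" and plateau: "\<And>\<xi>. \<xi> \<in> {s<..<t} \<Longrightarrow> \<phi> \<xi> = rbar" and x: "x \<in> {s<..<t}"
  shows "G x = c * rbar - f rbar" and "(G has_real_derivative - g (\<phi> x)) (at x)"
proof -
  have "deriv \<phi> \<xi> = 0" if "\<xi> \<in> {s<..<t}" for \<xi>
  proof (rule DERIV_imp_deriv)
    have "((\<lambda>\<xi>. rbar) has_real_derivative 0) (at \<xi>)" by simp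
    then show "(\<phi> has_real_derivative 0) (at \<xi>)"
      by (rule has_field_derivative_transform_within_open[of _ _ _ "{s<..<t}"]) (use that plateau in auto)
  qed
  then have G: "G \<xi> = c * rbar - f rbar" if "\<xi> \<in> {s<..<t}" for \<xi>
    using that plateau[of \<xi>] by (simp add: G_def)
  then show "G x = c * rbar - f rbar" using x by blast
  have "((\<lambda>\<xi>. c * rbar - f rbar) has_real_derivative - g (\<phi> x)) (at x)"
    using plateau[OF x] g_rbar by simp
  then show "(G has_real_derivative - g (\<phi> x)) (at x)"
    by (rule has_field_derivative_transform_within_open[of _ _ _ "{s<..<t}"]) (use x G in auto)
qed

lemma flux_no_jump:
  assumes "r > 0" "{a - r..a + r} \<subseteq> I"
    and "\<And>x. x \<in> {a - r..a + r} \<Longrightarrow> x \<noteq> a \<Longrightarrow> (G has_real_derivative - g (\<phi> x)) (at x)"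
    and "(G \<longlongrightarrow> Gl) (at_left a)" "(G \<longlongrightarrow> Gr) (at_right a)"
  shows "Gl = Gr"
proof (rule weak_solution_no_jump[of r a I "\<lambda>x. g (\<phi> x)" G])
  show "continuous_on I (\<lambda>x. g (\<phi> x))"
    using \<phi>_range by (intro continuous_on_compose2[OF g \<phi>_cont]) fastforce
  show "(LINT x:I|lebesgue. G x * deriv \<psi> x - g (\<phi> x) * \<psi> x) = 0" if "test_function I \<psi>" for \<psi>
    using profile that by (simp add: wave_profile_def traveling_wave_def G_def)
qed (use assms open_I in auto)

text \<open>The constant value of the flux on the plateau is its left limit at a, and the weak
  formulation carries it across a, where \<phi> may fail to be differentiable.\<close>

lemma no_jump_right_of_plateau:
  assumes I: "{s<..<t} \<subseteq> I" and a: "a \<in> {s<..<t}" and plateau: "\<And>x. x \<in> {s<..a} \<Longrightarrow> \<phi> x = rbar"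
    and below: "\<And>x. x \<in> {a<..<t} \<Longrightarrow> \<phi> x < rbar" and lim: "(G \<longlongrightarrow> l) (at_right a)"
  shows "l = c * rbar - f rbar"
proof -
  obtain r where r: "r > 0" "r < a - s" "r < t - a"
    using field_lbound_gt_zero[of "a - s" "t - a"] a by auto
  have sub: "{s<..<a} \<subseteq> I" using I a by force
  have plateau': "\<phi> x = rbar" if "x \<in> {s<..<a}" for x using plateau that by auto
  note pf = plateau_flux[OF sub plateau']
  have deriv: "(G has_real_derivative - g (\<phi> x)) (at x)" if "x \<in> {a - r..a + r}" "x \<noteq> a" for x
  proof (cases "x < a")
    case True
    then show ?thesis using pf(2) that r by auto
  next
    case False
    then have "x \<in> {s<..<t}" "\<phi> x < rbar" using below[of x] that r by auto
    then show ?thesis using DERIV_below(2)[of x] I by blast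
  qed
  have "\<forall>\<^sub>F x in at_left a. c * rbar - f rbar = G x"
    by (rule eventually_mono[OF eventually_at_left_real[of s a]]) (use a pf(1) in \<open>simp_all only: greaterThanLessThan_iff\<close>)
  then have "(G \<longlongrightarrow> c * rbar - f rbar) (at_left a)"
    by (rule Lim_transform_eventually[OF tendsto_const])
  moreover have "{a - r..a + r} \<subseteq> I" using I r by force
  ultimately show ?thesis using flux_no_jump[OF r(1) _ deriv] lim by blast
qed

text \<open>Proved for the profile before reflection, so that the weak formulation with its test
  functions need not be reflected.\<close>

lemma no_jump_left_of_plateau:
  assumes I: "{s<..<t} \<subseteq> I" and a: "a \<in> {s<..<t}" and plateau: "\<And>x. x \<in> {a..<t} \<Longrightarrow> \<phi> x = rbar"
    and below: "\<And>x. x \<in> {s<..<a} \<Longrightarrow> \<phi> x < rbar" and lim: "(G \<longlongrightarrow> l) (at_left a)"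
  shows "l = c * rbar - f rbar"
proof -
  obtain r where r: "r > 0" "r < a - s" "r < t - a"
    using field_lbound_gt_zero[of "a - s" "t - a"] a by auto
  have sub: "{a<..<t} \<subseteq> I" using I a by force
  have plateau': "\<phi> x = rbar" if "x \<in> {a<..<t}" for x using plateau that by auto
  note pf = plateau_flux[OF sub plateau']
  have deriv: "(G has_real_derivative - g (\<phi> x)) (at x)" if "x \<in> {a - r..a + r}" "x \<noteq> a" for x
  proof (cases "a < x")
    case True
    then show ?thesis using pf(2) that r by auto
  next
    case False
    then have "x \<in> {s<..<t}" "\<phi> x < rbar" using below[of x] that r by auto
    then show ?thesis using DERIV_below(2)[of x] I by blast
  qed
  have "\<forall>\<^sub>F x in at_right a. c * rbar - f rbar = G x"
    by (rule eventually_mono[OF eventually_at_right_real[of a t]]) (use a pf(1) in \<open>simp_all only: greaterThanLessThan_iff\<close>)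
  then have "(G \<longlongrightarrow> c * rbar - f rbar) (at_right a)"
    by (rule Lim_transform_eventually[OF tendsto_const])
  moreover have "{a - r..a + r} \<subseteq> I" using I r by force
  ultimately show ?thesis using flux_no_jump[OF r(1) _ deriv] lim by blast
qed

end

section \<open>Reduction of semi-wavefronts to decreasing profiles\<close>

lemma semi_wavefront_from_decreasing_profile:
  assumes rbar: "rbar > 0"
    and f: "\<And>r. r \<in> {0..rbar} \<Longrightarrow> (f has_real_derivative h r) (at r within {0..rbar})"
    and h: "continuous_on {0..rbar} h" and D: "continuous_on {0..rbar} D"
    and D_pos: "\<And>r. r \<in> {0<..<rbar} \<Longrightarrow> D r > 0"
    and g: "continuous_on {0..rbar} g"
    and g_pos: "\<And>r. r \<in> {0..<rbar} \<Longrightarrow> g r > 0" and g_rbar: "g rbar = 0"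
    and sw: "semi_wavefront_from rbar D f h g c w \<phi>"
  shows "decreasing_profile rbar c w f D g \<phi> (deriv \<phi>)"
proof -
  have wp: "wave_profile rbar D f h g c {..<w} \<phi>" and lim: "(\<phi> \<longlongrightarrow> rbar) at_bot"
    and nonconst: "\<not> \<phi> constant_on {..<w}" and cont: "continuous_on {..<w} \<phi>"
    and range: "\<And>\<xi>. \<xi> < w \<Longrightarrow> 0 \<le> \<phi> \<xi> \<and> \<phi> \<xi> \<le> rbar"
    using sw by (auto simp: semi_wavefront_from_def wave_profile_def traveling_wave_def)
  have less: "\<exists>\<xi><w. \<phi> \<xi> < rbar"
  proof (rule ccontr)
    assume "\<not> (\<exists>\<xi><w. \<phi> \<xi> < rbar)"
    then have "\<phi> \<xi> = rbar" if "\<xi> < w" for \<xi> using range that by force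
    then show False using nonconst by (auto simp: constant_on_def)
  qed
  have anti: "\<phi> \<eta> \<le> \<phi> \<xi>" if "\<xi> \<le> \<eta>" "\<eta> < w" for \<xi> \<eta>
  proof (cases "antimono_on {..<w} \<phi>")
    case True
    then show ?thesis using that by (auto simp: monotone_on_def)
  next
    case False
    then have mono: "mono_on {..<w} \<phi>" using sw by (auto simp: semi_wavefront_from_def)
    obtain \<zeta> where \<zeta>: "\<zeta> < w" "\<phi> \<zeta> < rbar" using less by blast
    \<comment> \<open>An increasing profile with limit rbar at -\<infinity> could never lie below
      rbar.\<close>
    have "rbar \<le> \<phi> \<zeta>"
    proof (rule tendsto_upperbound[OF lim])
      show "\<forall>\<^sub>F x in at_bot. \<phi> x \<le> \<phi> \<zeta>"
        using eventually_le_at_bot[of \<zeta>]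
        by (rule eventually_mono) (use mono \<zeta>(1) in \<open>auto simp: monotone_on_def\<close>)
    qed simp
    then show ?thesis using \<zeta>(2) by simp
  qed
  have pos: "0 < \<phi> \<xi>" if "\<xi> < w" for \<xi>
  proof (rule ccontr)
    assume "\<not> 0 < \<phi> \<xi>"
    then have "\<phi> \<eta> = 0" if "\<eta> \<in> {\<xi><..<w}" for \<eta>
      using anti[of \<xi> \<eta>] range[of \<eta>] that by auto
    then show False
      using wave_profile_not_locally_zero[OF wp g_pos rbar _ \<open>\<xi> < w\<close>] by force
  qed
  interpret positive_profile rbar c f h D g \<phi> "{..<w}"
    by unfold_locales (use assms wp pos in auto)
  show ?thesis
  proof
    fix \<xi> assume "\<xi> < w" "\<phi> \<xi> < rbar"
    then show "(\<phi> has_real_derivative deriv \<phi> \<xi>) (at \<xi>)"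
      "((\<lambda>\<xi>. D (\<phi> \<xi>) * deriv \<phi> \<xi> - f (\<phi> \<xi>) + c * \<phi> \<xi>) has_real_derivative - g (\<phi> \<xi>)) (at \<xi>)"
      using DERIV_below[of \<xi>] by (auto simp: G_def[abs_def])
  next
    fix a l assume "a < w" "\<And>\<xi>. \<xi> \<le> a \<Longrightarrow> \<phi> \<xi> = rbar" "\<And>\<xi>. a < \<xi> \<Longrightarrow> \<xi> < w \<Longrightarrow> \<phi> \<xi> < rbar"
      "((\<lambda>\<xi>. D (\<phi> \<xi>) * deriv \<phi> \<xi> - f (\<phi> \<xi>) + c * \<phi> \<xi>) \<longlongrightarrow> l) (at_right a)"
    then show "l = c * rbar - f rbar"
      by (intro no_jump_right_of_plateau[of "a - 1" w a]) (auto simp: G_def[abs_def])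
  next
    show "continuous_on {0..rbar} f" by (rule DERIV_continuous_on[OF f])
  qed (use assms range anti pos cont lim less in auto)
qed

text \<open>Under \<xi> \<rightarrow> -\<xi> the velocity changes sign; changing the signs of f and
  c as well turns the flux into -G(-\<xi>), whose derivative is again minus the reaction
  term.\<close>

lemma semi_wavefront_to_decreasing_profile:
  assumes rbar: "rbar > 0"
    and f: "\<And>r. r \<in> {0..rbar} \<Longrightarrow> (f has_real_derivative h r) (at r within {0..rbar})"
    and h: "continuous_on {0..rbar} h" and D: "continuous_on {0..rbar} D"
    and D_pos: "\<And>r. r \<in> {0<..<rbar} \<Longrightarrow> D r > 0"
    and g: "continuous_on {0..rbar} g"
    and g_pos: "\<And>r. r \<in> {0..<rbar} \<Longrightarrow> g r > 0" and g_rbar: "g rbar = 0"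
    and sw: "semi_wavefront_to rbar D f h g c w \<phi>"
  shows "decreasing_profile rbar (- c) (- w) (\<lambda>r. - f r) D g (\<lambda>\<xi>. \<phi> (- \<xi>)) (\<lambda>\<xi>. - deriv \<phi> (- \<xi>))"
proof -
  have wp: "wave_profile rbar D f h g c {w<..} \<phi>" and lim: "(\<phi> \<longlongrightarrow> rbar) at_top"
    and nonconst: "\<not> \<phi> constant_on {w<..}" and cont: "continuous_on {w<..} \<phi>"
    and range: "\<And>\<xi>. w < \<xi> \<Longrightarrow> 0 \<le> \<phi> \<xi> \<and> \<phi> \<xi> \<le> rbar"
    using sw by (auto simp: semi_wavefront_to_def wave_profile_def traveling_wave_def)
  have less: "\<exists>\<xi>>w. \<phi> \<xi> < rbar"
  proof (rule ccontr)
    assume "\<not> (\<exists>\<xi>>w. \<phi> \<xi> < rbar)"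
    then have "\<phi> \<xi> = rbar" if "w < \<xi>" for \<xi> using range that by force
    then show False using nonconst by (auto simp: constant_on_def)
  qed
  have mono: "\<phi> \<xi> \<le> \<phi> \<eta>" if "\<xi> \<le> \<eta>" "w < \<xi>" for \<xi> \<eta>
  proof (cases "mono_on {w<..} \<phi>")
    case True
    then show ?thesis using that by (auto simp: monotone_on_def)
  next
    case False
    then have anti: "antimono_on {w<..} \<phi>" using sw by (auto simp: semi_wavefront_to_def)
    obtain \<zeta> where \<zeta>: "w < \<zeta>" "\<phi> \<zeta> < rbar" using less by blast
    have "rbar \<le> \<phi> \<zeta>"
    proof (rule tendsto_upperbound[OF lim])
      show "\<forall>\<^sub>F x in at_top. \<phi> x \<le> \<phi> \<zeta>"
        using eventually_ge_at_top[of \<zeta>]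
        by (rule eventually_mono) (use anti \<zeta>(1) in \<open>auto simp: monotone_on_def\<close>)
    qed simp
    then show ?thesis using \<zeta>(2) by simp
  qed
  have pos: "0 < \<phi> \<xi>" if "w < \<xi>" for \<xi>
  proof (rule ccontr)
    assume "\<not> 0 < \<phi> \<xi>"
    then have "\<phi> \<eta> = 0" if "\<eta> \<in> {w<..<\<xi>}" for \<eta>
      using mono[of \<eta> \<xi>] range[of \<eta>] that by auto
    then show False
      using wave_profile_not_locally_zero[OF wp g_pos rbar _ \<open>w < \<xi>\<close>] by force
  qed
  interpret positive_profile rbar c f h D g \<phi> "{w<..}"
    by unfold_locales (use assms wp pos in auto)
  have reflect: "(\<lambda>\<xi>. D (\<phi> (- \<xi>)) * - deriv \<phi> (- \<xi>) - - f (\<phi> (- \<xi>)) + - c * \<phi> (- \<xi>)) = (\<lambda>\<xi>. - G (- \<xi>))"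
    by (auto simp: G_def)
  have DERIV_reflect: "((\<lambda>\<xi>. F (- \<xi>)) has_real_derivative - F') (at \<xi>)"
    if "(F has_real_derivative F') (at (- \<xi>))" for F F' \<xi>
    using DERIV_chain2[OF that DERIV_minus[OF DERIV_ident]] by simp
  show ?thesis
  proof
    fix \<xi> assume *: "\<xi> < - w" "\<phi> (- \<xi>) < rbar"
    then show "((\<lambda>\<xi>. \<phi> (- \<xi>)) has_real_derivative - deriv \<phi> (- \<xi>)) (at \<xi>)"
      using DERIV_below(1)[of "- \<xi>"] by (intro DERIV_reflect) auto
    show "((\<lambda>\<xi>. D (\<phi> (- \<xi>)) * - deriv \<phi> (- \<xi>) - - f (\<phi> (- \<xi>)) + - c * \<phi> (- \<xi>))
        has_real_derivative - g (\<phi> (- \<xi>))) (at \<xi>)"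
      unfolding reflect using DERIV_minus[OF DERIV_reflect[OF DERIV_below(2)[of "- \<xi>"]]] * by simp
  next
    fix a l assume *: "a < - w" "\<And>\<xi>. \<xi> \<le> a \<Longrightarrow> \<phi> (- \<xi>) = rbar"
        "\<And>\<xi>. a < \<xi> \<Longrightarrow> \<xi> < - w \<Longrightarrow> \<phi> (- \<xi>) < rbar"
      and lim: "((\<lambda>\<xi>. D (\<phi> (- \<xi>)) * - deriv \<phi> (- \<xi>) - - f (\<phi> (- \<xi>)) + - c * \<phi> (- \<xi>)) \<longlongrightarrow> l) (at_right a)"
    \<comment> \<open>The right neighbourhood of a becomes the left neighbourhood of -a.\<close>
    have "((\<lambda>\<xi>. - G \<xi>) \<longlongrightarrow> l) (at_left (- a))"
      using lim unfolding reflect by (simp add: filterlim_at_left_to_right)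
    then have "(G \<longlongrightarrow> - l) (at_left (- a))"
      using tendsto_minus by fastforce
    moreover have "\<phi> x = rbar" if "- a \<le> x" for x using *(2)[of "- x"] that by simp
    moreover have "\<phi> x < rbar" if "w < x" "x < - a" for x using *(3)[of "- x"] that by simp
    ultimately have "- l = c * rbar - f rbar"
      using *(1) by (intro no_jump_left_of_plateau[of w "- a + 1" "- a"]) auto
    then show "l = - c * rbar - - f rbar" by simp
  next
    show "continuous_on {0..rbar} (\<lambda>r. - f r)" by (intro continuous_on_minus DERIV_continuous_on[OF f])
    show "continuous_on {..< - w} (\<lambda>\<xi>. \<phi> (- \<xi>))"
      by (intro continuous_on_compose2[OF cont] continuous_intros) auto
    show "((\<lambda>\<xi>. \<phi> (- \<xi>)) \<longlongrightarrow> rbar) at_bot"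
      by (rule filterlim_compose[OF lim filterlim_uminus_at_top_at_bot])
    obtain \<zeta> where "w < \<zeta>" "\<phi> \<zeta> < rbar" using less by blast
    then show "\<exists>\<xi>. \<xi> < - w \<and> \<phi> (- \<xi>) < rbar" by (intro exI[of _ "- \<zeta>"]) auto
  qed (use assms range mono pos in auto)
qed

theorem theorem2p3:
  fixes rbar c w L :: real and f h D D' g \<phi> :: "real \<Rightarrow> real"
  assumes "rbar > 0"
    and "\<And>r. r \<in> {0..rbar} \<Longrightarrow> (f has_real_derivative h r) (at r within {0..rbar})"
    and "continuous_on {0..rbar} h"
    and "f 0 = 0"
    and "\<And>r. r \<in> {0..rbar} \<Longrightarrow> (D has_real_derivative D' r) (at r within {0..rbar})"
    and "continuous_on {0..rbar} D'"
    and "D rbar = 0"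
    and "\<And>r. r \<in> {0<..<rbar} \<Longrightarrow> D r > 0"
    and "continuous_on {0..rbar} g"
    and "\<And>r. r \<in> {0..<rbar} \<Longrightarrow> g r > 0"
    and "g rbar = 0"
    and "L > 0"
  shows
    "(semi_wavefront_from rbar D f h g c w \<phi> \<longrightarrow>
       ((\<forall>\<^sub>F r in at_left rbar. g r \<le> L * (rbar - r)) \<and> c > h rbar \<longrightarrow>
          strict_antimono_on {..<w} \<phi> \<and> (\<forall>\<xi>\<in>{..<w}. \<phi> \<xi> < rbar)) \<and>
       ((\<exists>\<alpha>\<in>{0<..<1}. \<forall>\<^sub>F r in at_left rbar. g r \<ge> L * (rbar - r) powr \<alpha>) \<longrightarrow>
          \<not> strict_antimono_on {..<w} \<phi> \<and> (\<exists>\<xi>\<^sub>1\<in>{..<w}. \<forall>\<xi>\<in>{..\<xi>\<^sub>1}. \<phi> \<xi> = rbar)))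
     \<and>
     (semi_wavefront_to rbar D f h g c w \<phi> \<longrightarrow>
       ((\<forall>\<^sub>F r in at_left rbar. g r \<le> L * (rbar - r)) \<and> c < h rbar \<longrightarrow>
          strict_mono_on {w<..} \<phi> \<and> (\<forall>\<xi>\<in>{w<..}. \<phi> \<xi> < rbar)) \<and>
       ((\<exists>\<alpha>\<in>{0<..<1}. \<forall>\<^sub>F r in at_left rbar. g r \<ge> L * (rbar - r) powr \<alpha>) \<longrightarrow>
          \<not> strict_mono_on {w<..} \<phi> \<and> (\<exists>\<xi>\<^sub>1\<in>{w<..}. \<forall>\<xi>\<in>{\<xi>\<^sub>1..}. \<phi> \<xi> = rbar)))"
proof -
  note data = assms(1-3) DERIV_continuous_on[OF assms(5)] assms(8-11)
  \<comment> \<open>D(rbar) = 0 turns the Lipschitz bound into a bound of D by the gap.\<close>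
  have lip_D: "\<exists>M>0. \<forall>r\<in>{0..rbar}. D r \<le> M * (rbar - r)"
  proof -
    obtain M where M: "M > 0" "M-lipschitz_on {0..rbar} D"
      using continuous_derivative_lipschitz[OF assms(5,6)] by blast
    have "D r \<le> M * (rbar - r)" if "r \<in> {0..rbar}" for r
      using lipschitz_onD[OF M(2) that, of rbar] that \<open>D rbar = 0\<close> \<open>rbar > 0\<close> by (auto simp: dist_real_def)
    with M(1) show ?thesis by blast
  qed
  then obtain M where M: "M > 0" "\<And>r. r \<in> {0..rbar} \<Longrightarrow> D r \<le> M * (rbar - r)" by blast
  have q_deriv: "((\<lambda>r. c * r - f r) has_real_derivative c - h r) (at r within {0..rbar})"
    if "r \<in> {0..rbar}" for r
    using DERIV_diff[OF DERIV_cmult_Id[of c] assms(2)[OF that]] by simp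
  have "continuous_on {0..rbar} (\<lambda>r. c - h r)" by (intro continuous_intros assms(3))
  from continuous_derivative_lipschitz[OF q_deriv this]
  obtain K where K: "K > 0" "K-lipschitz_on {0..rbar} (\<lambda>r. c * r - f r)" by blast
  \<comment> \<open>The absolute value serves both directions, as reflection replaces q by
    -q.\<close>
  have K': "\<bar>(c * rbar - f rbar) - (c * r - f r)\<bar> \<le> K * (rbar - r)" if "r \<in> {0..rbar}" for r
    using lipschitz_onD[OF K(2) _ that, of rbar] that \<open>rbar > 0\<close> by (auto simp: dist_real_def)
  show ?thesis
  proof (intro conjI impI)
    assume "semi_wavefront_from rbar D f h g c w \<phi>"
    then interpret decreasing_profile rbar c w f D g \<phi> "deriv \<phi>"
      by (intro semi_wavefront_from_decreasing_profile[OF data])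
    {
      assume *: "(\<forall>\<^sub>F r in at_left rbar. g r \<le> L * (rbar - r)) \<and> c > h rbar"
      \<comment> \<open>The slope of q at rbar is c - h(rbar) > 0; half of it serves as
        \<eta>.\<close>
      have "\<forall>\<^sub>F r in at_left rbar. (c - h rbar) / 2 * (rbar - r) \<le> q rbar - q r"
        unfolding q_def using q_deriv[of rbar] * rbar by (intro has_derivative_pos_eventually_at_left) auto
      then have less: "\<phi> \<xi> < rbar" if "\<xi> < w" for \<xi>
        using no_plateau[of L "(c - h rbar) / 2" \<xi>] * \<open>L > 0\<close> that by auto
      then show "\<forall>\<xi>\<in>{..<w}. \<phi> \<xi> < rbar" by blast
      show "strict_antimono_on {..<w} \<phi>"
        using strictly_decreasing less by (auto intro!: monotone_onI)
    }
    assume "\<exists>\<alpha>\<in>{0<..<1}. \<forall>\<^sub>F r in at_left rbar. g r \<ge> L * (rbar - r) powr \<alpha>"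
    then obtain \<alpha> where "0 < \<alpha>" "\<alpha> < 1" "\<forall>\<^sub>F r in at_left rbar. L * (rbar - r) powr \<alpha> \<le> g r" by auto
    moreover have "q rbar - q r \<le> K * (rbar - r)" if "r \<in> {0..rbar}" for r
      using K'[OF that] by (simp add: q_def)
    ultimately obtain \<xi> where \<xi>: "\<xi> < w" "\<And>\<zeta>. \<zeta> \<le> \<xi> \<Longrightarrow> \<phi> \<zeta> = rbar"
      using plateau_exists[of \<alpha> L K M] \<open>L > 0\<close> K(1) M by blast
    then show "\<exists>\<xi>\<^sub>1\<in>{..<w}. \<forall>\<xi>\<in>{..\<xi>\<^sub>1}. \<phi> \<xi> = rbar" by auto
    show "\<not> strict_antimono_on {..<w} \<phi>"
    proof
      assume "strict_antimono_on {..<w} \<phi>"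
      then have "\<phi> \<xi> < \<phi> (\<xi> - 1)" by (rule monotone_onD) (use \<xi>(1) in auto)
      then show False using \<xi>(2)[of \<xi>] \<xi>(2)[of "\<xi> - 1"] by simp
    qed
  next
    assume "semi_wavefront_to rbar D f h g c w \<phi>"
    then interpret decreasing_profile rbar "- c" "- w" "\<lambda>r. - f r" D g "\<lambda>\<xi>. \<phi> (- \<xi>)" "\<lambda>\<xi>. - deriv \<phi> (- \<xi>)"
      by (intro semi_wavefront_to_decreasing_profile[OF data])
    {
      assume *: "(\<forall>\<^sub>F r in at_left rbar. g r \<le> L * (rbar - r)) \<and> c < h rbar"
      have "((\<lambda>r. - c * r - - f r) has_real_derivative h rbar - c) (at rbar within {0..rbar})"
        using DERIV_minus[OF q_deriv[of rbar]] rbar by simp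
      then have "\<forall>\<^sub>F r in at_left rbar. (h rbar - c) / 2 * (rbar - r) \<le> q rbar - q r"
        unfolding q_def using * rbar by (intro has_derivative_pos_eventually_at_left) auto
      then have less: "\<phi> \<xi> < rbar" if "w < \<xi>" for \<xi>
        using no_plateau[of L "(h rbar - c) / 2" "- \<xi>"] * \<open>L > 0\<close> that by auto
      then show "\<forall>\<xi>\<in>{w<..}. \<phi> \<xi> < rbar" by blast
      show "strict_mono_on {w<..} \<phi>"
      proof (rule monotone_onI)
        fix \<xi> \<eta> assume "\<xi> \<in> {w<..}" "\<eta> \<in> {w<..}" "\<xi> < \<eta>"
        then show "\<phi> \<xi> < \<phi> \<eta>" using strictly_decreasing[of "- \<eta>" "- \<xi>"] less[of \<eta>] by simp
      qed
    }
    assume "\<exists>\<alpha>\<in>{0<..<1}. \<forall>\<^sub>F r in at_left rbar. g r \<ge> L * (rbar - r) powr \<alpha>"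
    then obtain \<alpha> where "0 < \<alpha>" "\<alpha> < 1" "\<forall>\<^sub>F r in at_left rbar. L * (rbar - r) powr \<alpha> \<le> g r" by auto
    moreover have "q rbar - q r \<le> K * (rbar - r)" if "r \<in> {0..rbar}" for r
      using K'[OF that] by (simp add: q_def)
    ultimately obtain \<xi> where \<xi>: "\<xi> < - w" "\<And>\<zeta>. \<zeta> \<le> \<xi> \<Longrightarrow> \<phi> (- \<zeta>) = rbar"
      using plateau_exists[of \<alpha> L K M] \<open>L > 0\<close> K(1) M by blast
    then have plateau: "\<phi> \<zeta> = rbar" if "- \<xi> \<le> \<zeta>" for \<zeta> using that \<xi>(2)[of "- \<zeta>"] by simp
    with \<xi>(1) show "\<exists>\<xi>\<^sub>1\<in>{w<..}. \<forall>\<xi>\<in>{\<xi>\<^sub>1..}. \<phi> \<xi> = rbar" by (intro bexI[of _ "- \<xi>"]) auto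
    show "\<not> strict_mono_on {w<..} \<phi>"
    proof
      assume "strict_mono_on {w<..} \<phi>"
      then have "\<phi> (- \<xi>) < \<phi> (- \<xi> + 1)" by (rule monotone_onD) (use \<xi>(1) in auto)
      then show False using plateau[of "- \<xi>"] plateau[of "- \<xi> + 1"] by simp
    qed
  qed
qed

end
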